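(* Let $q$ be an odd prime power, $s$ a positive integer, $n=\frac{q^{2s}-1}{q+1}$, and let $\delta_{1,n}$ and $\delta_{2,n}$ be the largest and second largest $q$-cyclotomic coset leaders modulo $n$. - If $s=3$, then for $\delta_{2,n}+1\leq\delta\leq\delta_{1,n}$ the code $\mathcal{C}_{(q,n,\delta)}$ has length $\frac{q^6-1}{q+1}$, dimension $4$ and minimum distance $d\geq\delta$; and $\mathcal{C}_{(q,n,\delta_{2,n})}$ has dimension $10$ and minimum distance $d\geq\delta_{2,n}$. - If $s=4$, then for $\delta_{2,n}+1\leq\delta\leq\delta_{1,n}$ the code $\mathcal{C}_{(q,n,\delta)}$ has length $\frac{q^8-1}{q+1}$, dimension $9$ and minimum distance $d\geq\delta$; and $\mathcal{C}_{(q,n,\delta_{2,n})}$ has dimension $17$ and minimum distance $d\geq\delta_{2,n}$. - If $s=6$, then for $\delta_{2,n}+1\leq\delta\leq\delta_{1,n}$ the code $\mathcal{C}_{(q,n,\delta)}$ has length $\frac{q^{12}-1}{q+1}$, dimension $13$ and minimum distance $d\geq\delta$; and $\mathcal{C}_{(q,n,\delta_{2,n})}$ has dimension $25$ and minimum distance $d\geq\delta_{2,n}$.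
   Context: Let $\alpha$ be a generator of $\mathbb{F}_{q^{2s}}^*$ and $\beta_1=\alpha^{q+1}$, a primitive $n$-th root of unity. For an integer $j$ let $m_j(x)$ be the minimal polynomial of $\beta_1^j$ over $\mathbb{F}_q$. For $2\le\delta\le n$, the narrow-sense BCH code $\mathcal{C}_{(q,n,\delta)}$ is the cyclic code of length $n$ over $\mathbb{F}_q$ (an ideal of $\mathbb{F}_q[x]/\langle x^n-1\rangle$) generated by $\mathrm{lcm}(m_1(x),\dots,m_{\delta-1}(x))$. The $q$-cyclotomic coset of $t$ modulo $n$ is $C_t=\{tq^j\bmod n: j\ge 0\}$; its smallest element is its coset leader; $\delta_{i,n}$ denotes the $i$-th largest $q$-cyclotomic coset leader modulo $n$.
   Formalization: For s=4 the dimension 17 of the code with δ=δ_{2,n} is claimed only for q≠3: when q=3, n=1640, the second largest coset leader is 1025 with coset {1025,1435} of size 2, so the dimension there is 11. *)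

theory Defs
  imports
    "Jordan_Normal_Form.VS_Connect"
    "HOL-Computational_Algebra.Computational_Algebra"
    "HOL-Number_Theory.Number_Theory"
    "HOL-Library.Cardinality"
begin

definition cyclotomic_coset :: "nat \<Rightarrow> nat \<Rightarrow> nat \<Rightarrow> nat set" where
  "cyclotomic_coset q n t = {t * q ^ j mod n | j. True}"

definition coset_leaders :: "nat \<Rightarrow> nat \<Rightarrow> nat set" where
  "coset_leaders q n = {Min (cyclotomic_coset q n t) | t. t < n}"

(* The i-th largest leader, for i = 1, 2, ...; the set of leaders includes 0.
   A pitfall for q = 3, n = 1640 = (3^8 - 1) / 4: the second largest leader is 1025, whose coset
   {1025, 1435} has only 2 elements instead of 8. The BCH code with designed distance 1025 then has
   dimension 1 + 8 + 2 = 11, which is why the dimension 17 is only claimed for q \<noteq> 3. *)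
definition nth_largest_leader :: "nat \<Rightarrow> nat \<Rightarrow> nat \<Rightarrow> nat" where
  "nth_largest_leader q n i = rev (sorted_list_of_set (coset_leaders q n)) ! (i - 1)"

(* The field extension is given by an embedding \<phi> of the small field 'a into the large field 'b. *)
definition minimal_poly :: "('a::field \<Rightarrow> 'b::field) \<Rightarrow> 'b \<Rightarrow> 'a poly" where
  "minimal_poly \<phi> x = (THE p. lead_coeff p = 1 \<and> poly (map_poly \<phi> p) x = 0 \<and>
     (\<forall>r. r \<noteq> 0 \<and> poly (map_poly \<phi> r) x = 0 \<longrightarrow> degree p \<le> degree r))"

(* A word (c_0, ..., c_(n-1)) is identified with the class of c_0 + c_1 x + ... modulo x^n - 1;
   the code is then the ideal generated by the class of g. *)
definition cyclic_code :: "nat \<Rightarrow> 'a::field_gcd poly \<Rightarrow> 'a vec set" where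
  "cyclic_code n g =
     {c \<in> carrier_vec n. \<exists>u. [Poly (list_of_vec c) = g * u] (mod (Polynomial.monom 1 n - 1))}"

(* The class field_gcd instead of field only serves to make Lcm available on polynomials
   (where it is the monic least common multiple). *)
definition bch_code :: "('a::field_gcd \<Rightarrow> 'b::field) \<Rightarrow> 'b \<Rightarrow> nat \<Rightarrow> nat \<Rightarrow> 'a vec set" where
  "bch_code \<phi> \<beta> n \<delta> = cyclic_code n (Lcm ((\<lambda>j. minimal_poly \<phi> (\<beta> ^ j)) ` {1..\<delta> - 1}))"

definition linear_code :: "nat \<Rightarrow> 'a::field vec set \<Rightarrow> bool" where
  "linear_code n C \<longleftrightarrow> VectorSpace.subspace class_ring C (module_vec TYPE('a) n)"

definition code_dim :: "nat \<Rightarrow> 'a::field vec set \<Rightarrow> nat" where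
  "code_dim n C = vectorspace.dim class_ring (module_vec TYPE('a) n\<lparr>carrier := C\<rparr>)"

definition hamming_dist :: "'a vec \<Rightarrow> 'a vec \<Rightarrow> nat" where
  "hamming_dist u v = card {i. i < dim_vec u \<and> u $ i \<noteq> v $ i}"

definition min_dist :: "'a vec set \<Rightarrow> nat" where
  "min_dist C = Inf {hamming_dist u v | u v. u \<in> C \<and> v \<in> C \<and> u \<noteq> v}"

end

theory Submission
  imports Defs "Jordan_Normal_Form.Char_Poly"
begin

text \<open>
  The code consists of the words vanishing at \<open>\<beta>\<^sub>1\<^sup>j\<close> for \<open>1 \<le> j < \<delta>\<close>. By Frobenius these are the words divisible
  by a polynomial over the small field whose roots are the \<open>\<beta>\<^sub>1\<^sup>i\<close> with \<open>i\<close> in the cyclotomic cosets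
  of \<open>1, \<dots>, \<delta> - 1\<close>, so the dimension is the number of residues outside these cosets: \<open>0\<close> and the
  cosets with leader at least \<open>\<delta>\<close>.

  A leader \<open>n - u\<close> is large iff the largest element of the coset of \<open>u\<close> is small. Multiplication by
  \<open>q + 1\<close> turns this coset into the cyclic rotations of a word of \<open>2 s\<close> digits in base \<open>q\<close> whose alternating
  digit sum is divisible by \<open>q + 1\<close>. Among those the maximal rotation is smallest for words with two
  digits 1, at odd distance \<open>g\<close> as large as possible: \<open>g = 3, 1\<close> for \<open>s = 3\<close> and \<open>s = 4\<close>, and
  \<open>g = 5, 3\<close> for \<open>s = 6\<close>. Only for \<open>q = 3\<close>, \<open>s = 4\<close> does the word \<open>10101010\<close>, with alternating sum \<open>4\<close>,
  intervene.
\<close>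

subsection \<open>Cyclotomic cosets and their leaders\<close>

lemma sorted_list_of_set_Max:
  fixes L :: "nat set"
  assumes "finite L" "L \<noteq> {}"
  shows "sorted_list_of_set L = sorted_list_of_set (L - {Max L}) @ [Max L]"
proof (rule sorted_distinct_set_unique)
  show "set (sorted_list_of_set L) = set (sorted_list_of_set (L - {Max L}) @ [Max L])"
    using assms Max_in[OF assms] by (simp add: insert_absorb)
qed (use assms Max_in[OF assms] in \<open>auto simp: sorted_append\<close>)

lemma nth_largest_leader_1:
  assumes "finite (coset_leaders q n)" "coset_leaders q n \<noteq> {}"
  shows "nth_largest_leader q n 1 = Max (coset_leaders q n)"
  using sorted_list_of_set_Max[OF assms] by (simp add: nth_largest_leader_def)

lemma nth_largest_leader_2:
  assumes "finite (coset_leaders q n)" "coset_leaders q n \<noteq> {}"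
    and "coset_leaders q n - {Max (coset_leaders q n)} \<noteq> {}" (is "?L \<noteq> {}")
  shows "nth_largest_leader q n 2 = Max ?L"
  using sorted_list_of_set_Max[OF assms(1,2)] sorted_list_of_set_Max[of ?L] assms
  by (simp add: nth_largest_leader_def)

text \<open>The period \<open>m\<close> of the powers of \<open>q\<close> makes multiplication by
  \<open>q\<close> invertible modulo \<open>n\<close>, so that the cosets partition the
  residues.\<close>

locale cyclotomic =
  fixes q n m :: nat
  assumes n_gt_1: "n > 1" and m_pos: "m > 0" and q_pow_m: "[q ^ m = 1] (mod n)"
begin

abbreviation "C \<equiv> cyclotomic_coset q n"
abbreviation "leader t \<equiv> Min (C t)"

lemma coset_subset: "C t \<subseteq> {..<n}"
  using n_gt_1 by (auto simp: cyclotomic_coset_def)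

lemma finite_coset [simp]: "finite (C t)"
  by (rule finite_subset[OF coset_subset]) simp

lemma cosetI: "t * q ^ j mod n \<in> C t"
  by (auto simp: cyclotomic_coset_def)

lemma self_in_coset: "t < n \<Longrightarrow> t \<in> C t"
  using cosetI[of t 0] by simp

lemma coset_nonempty [simp]: "C t \<noteq> {}"
  using cosetI by blast

lemma q_pow_mult_m: "[q ^ (m * k) = 1] (mod n)"
  using cong_pow[OF q_pow_m, of k] by (simp add: power_mult)

lemma q_pow_mod: "[q ^ (j mod m) = q ^ j] (mod n)"
proof -
  have "[q ^ (j mod m) * 1 = q ^ (j mod m) * q ^ (m * (j div m))] (mod n)"
    by (intro cong_mult cong_refl cong_sym[OF q_pow_mult_m])
  moreover have "q ^ (j mod m) * q ^ (m * (j div m)) = q ^ j"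
    by (simp flip: power_add)
  ultimately show ?thesis
    by (metis mult_1_right)
qed

lemma coset_eq_image: "C t = (\<lambda>j. t * q ^ j mod n) ` {..<m}"
proof -
  have "\<exists>i<m. t * q ^ j mod n = t * q ^ i mod n" for j
    using q_pow_mod[of j] m_pos
    by (intro exI[of _ "j mod m"]) (auto simp: cong_def intro: mod_mult_cong)
  then show ?thesis
    by (auto simp: cyclotomic_coset_def image_iff)
qed

lemma coset_mult: "u \<in> C t \<Longrightarrow> u * q ^ j mod n \<in> C t"
  by (auto simp: cyclotomic_coset_def mod_mult_left_eq mult.assoc simp flip: power_add)

text \<open>Multiplication by \<open>q ^ (m - j)\<close> undoes multiplication by
  \<open>q ^ j\<close> modulo \<open>n\<close>.\<close>

lemma coset_sym:
  assumes "t < n" "u \<in> C t"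
  shows "t \<in> C u"
proof -
  obtain j where j: "j < m" "u = t * q ^ j mod n"
    using assms by (auto simp: coset_eq_image)
  have "u * q ^ (m - j) mod n = t * q ^ m mod n"
    using j by (simp add: mod_mult_left_eq mult.assoc flip: power_add)
  also have "[t * q ^ m = t * 1] (mod n)"
    by (intro cong_mult cong_refl q_pow_m)
  then have "t * q ^ m mod n = t"
    using assms by (simp add: cong_def)
  finally show ?thesis
    using cosetI[of u "m - j"] by simp
qed

lemma coset_trans: "u \<in> C t \<Longrightarrow> v \<in> C u \<Longrightarrow> v \<in> C t"
  using coset_mult by (auto simp: cyclotomic_coset_def[of q n u])

lemma coset_eq:
  assumes "t < n" "u \<in> C t"
  shows "C u = C t"
  using assms coset_trans coset_sym by blast

lemma leader_in: "leader t \<in> C t"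
  by simp

lemma leader_le: "t < n \<Longrightarrow> leader t \<le> t"
  by (simp add: self_in_coset)

lemma coset_0 [simp]: "C 0 = {0}"
  by (auto simp: cyclotomic_coset_def)

lemma coset_pos:
  assumes "0 < t" "t < n" "u \<in> C t"
  shows "0 < u"
proof (rule ccontr)
  assume "\<not> 0 < u"
  then have "C 0 = C t"
    using assms coset_eq by fastforce
  then show False
    using assms self_in_coset[of t] by (metis coset_0 less_irrefl singletonD)
qed

lemma leader_eq_0_iff: "t < n \<Longrightarrow> leader t = 0 \<longleftrightarrow> t = 0"
  using coset_pos[OF _ _ leader_in, of t] leader_le[of t] by fastforce

text \<open>Negation modulo \<open>n\<close> commutes with multiplication by \<open>q\<close>. For
  \<open>t > 0\<close> the coset avoids 0, so \<open>n - u\<close> is again a reduced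
  residue.\<close>

lemma coset_negate:
  assumes "0 < t" "t < n"
  shows "C (n - t) = (\<lambda>u. n - u) ` C t"
proof -
  have "(n - t) * q ^ j mod n = n - t * q ^ j mod n" for j
  proof -
    define r where "r = t * q ^ j mod n"
    have r: "0 < r" "r < n"
      using coset_pos[OF assms cosetI[of t j]] n_gt_1 by (auto simp: r_def)
    \<comment> \<open>Both sides are multiples of \<open>n\<close>; adding \<open>r\<close> first
      and cancelling it later avoids truncated subtraction.\<close>
    have "[(n - t) * q ^ j + t * q ^ j = (n - r) + r] (mod n)"
      using assms r by (simp add: cong_def flip: distrib_right)
    moreover have "[t * q ^ j = r] (mod n)"
      by (simp add: r_def cong_def)
    ultimately have "[(n - t) * q ^ j + r = (n - r) + r] (mod n)"
      using cong_trans[OF cong_add[OF cong_refl cong_sym]] by blast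
    then have "[(n - t) * q ^ j = n - r] (mod n)"
      unfolding cong_add_rcancel_nat .
    then show ?thesis
      using r by (simp add: cong_def flip: r_def)
  qed
  then show ?thesis
    by (auto simp: cyclotomic_coset_def)
qed

lemma coset_leaders_eq: "coset_leaders q n = leader ` {..<n}"
  by (auto simp: coset_leaders_def)

lemma finite_leaders: "finite (coset_leaders q n)"
  by (simp add: coset_leaders_eq)

lemma zero_in_leaders: "0 \<in> coset_leaders q n"
  unfolding coset_leaders_eq using n_gt_1 by (intro rev_image_eqI[of 0]) auto

lemma complement_cosets:
  assumes "\<delta> \<le> n"
  shows "{..<n} - (\<Union>j\<in>{1..\<delta> - 1}. C j) = {t. t < n \<and> (t = 0 \<or> \<delta> \<le> leader t)}"
proof (intro Set.set_eqI iffI)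
  fix t assume t: "t \<in> {..<n} - (\<Union>j\<in>{1..\<delta> - 1}. C j)"
  have "t \<in> C (leader t)"
    using t coset_sym leader_in by auto
  then have "leader t \<notin> {1..\<delta> - 1}"
    using t by blast
  then show "t \<in> {t. t < n \<and> (t = 0 \<or> \<delta> \<le> leader t)}"
    using t leader_eq_0_iff[of t] by (cases "leader t = 0") (auto simp del: Min_ge_iff)
next
  fix t assume t: "t \<in> {t. t < n \<and> (t = 0 \<or> \<delta> \<le> leader t)}"
  have False if j: "j \<in> {1..\<delta> - 1}" "t \<in> C j" for j
  proof -
    have "j < n"
      using j assms by auto
    then have "leader t \<le> j" "t \<noteq> 0"
      using coset_eq[OF _ j(2)] leader_le[of j] coset_pos[of j t] j by auto
    then show False
      using t j by (auto simp del: Min_ge_iff)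
  qed
  then have "t \<notin> (\<Union>j\<in>{1..\<delta> - 1}. C j)"
    by blast
  then show "t \<in> {..<n} - (\<Union>j\<in>{1..\<delta> - 1}. C j)"
    using t by simp
qed

text \<open>Negation reverses the order of the nonzero residues, so large leaders correspond to
  cosets with a small maximum.\<close>

lemma leader_negate:
  assumes "0 < u" "u < n"
  shows "leader (n - u) = n - Max (C u)"
proof (rule Min_eqI)
  fix y assume "y \<in> C (n - u)"
  then obtain x where "x \<in> C u" "y = n - x"
    using coset_negate[OF assms] by auto
  then show "n - Max (C u) \<le> y"
    by (simp add: diff_le_mono2)
next
  show "n - Max (C u) \<in> C (n - u)"
    using coset_negate[OF assms] Max_in[of "C u"] by auto
qed simp

lemma card_coset_negate:
  assumes "0 < u" "u < n"
  shows "card (C (n - u)) = card (C u)"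
  unfolding coset_negate[OF assms]
  by (rule card_image, rule inj_onI) (use coset_subset[of u] in \<open>force simp: subset_iff\<close>)

lemma leader_le_negate:
  assumes t: "0 < t" "t < n" and v: "v \<in> C (n - t)"
  shows "leader t \<le> n - v"
proof -
  have "leader (n - (n - t)) = n - Max (C (n - t))"
    by (rule leader_negate) (use t in auto)
  moreover have "v \<le> Max (C (n - t))"
    using v by simp
  ultimately show ?thesis
    using t by (simp add: diff_le_mono2)
qed

lemma mem_coset_negate:
  assumes "0 < t" "t < n" "n - t \<in> C u" "0 < u" "u < n"
  shows "t \<in> C (n - u)"
  using assms by (auto simp: coset_negate intro!: rev_image_eqI[of "n - t"])

lemma mem_coset_leader_iff:
  assumes "s < n" "t < n" "leader s = s"
  shows "leader t = s \<longleftrightarrow> t \<in> C s"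
  using assms coset_eq[of s t] coset_eq[OF assms(2) leader_in] self_in_coset[of t] by auto

text \<open>Every nonzero coset other than that of \<open>u\<^sub>1\<close> reaches beyond
  \<open>u\<^sub>1\<close>; after negation its leader lies below
  \<open>n - u\<^sub>1\<close>.\<close>

lemma first_leader:
  assumes u: "0 < u\<^sub>1" "u\<^sub>1 < n" and max: "\<forall>v\<in>C u\<^sub>1. v \<le> u\<^sub>1"
    and other: "\<forall>u. 0 < u \<and> u < n \<longrightarrow> u \<in> C u\<^sub>1 \<or> (\<exists>v\<in>C u. u\<^sub>1 < v)"
  shows "nth_largest_leader q n 1 = n - u\<^sub>1"
    and "nth_largest_leader q n 2 = Max (coset_leaders q n - {n - u\<^sub>1})"
    and "nth_largest_leader q n 2 < n - u\<^sub>1"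
    and "leader (n - u\<^sub>1) = n - u\<^sub>1"
proof -
  let ?L = "coset_leaders q n" and ?t = "n - u\<^sub>1"
  have "Max (C u\<^sub>1) = u\<^sub>1"
    using max self_in_coset[OF u(2)] by (intro Max_eqI) auto
  then show lead: "leader ?t = ?t"
    using leader_negate[OF u] by simp
  have le: "leader t \<le> ?t" if t: "t < n" for t
  proof (cases "t = 0")
    case False
    then have t': "0 < n - t" "n - t < n"
      using t by auto
    show ?thesis
    proof (rule disjE[OF other[rule_format, OF conjI[OF t']]])
      assume "n - t \<in> C u\<^sub>1"
      then have "t \<in> C ?t"
        using False t u mem_coset_negate by simp
      then show ?thesis
        using coset_eq[of ?t t] lead u by simp
    next
      assume "\<exists>v\<in>C (n - t). u\<^sub>1 < v"
      then obtain v where "v \<in> C (n - t)" "u\<^sub>1 < v" by auto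
      then show ?thesis
        using leader_le_negate[of t v] False t by auto
    qed
  qed simp
  have t_in: "?t \<in> ?L"
    using lead u unfolding coset_leaders_eq by (intro rev_image_eqI[of ?t]) auto
  have ne: "?L \<noteq> {}"
    using t_in by auto
  have Max: "Max ?L = ?t"
    by (rule Max_eqI) (use le t_in finite_leaders in \<open>auto simp: coset_leaders_eq\<close>)
  then show "nth_largest_leader q n 1 = ?t"
    using nth_largest_leader_1[OF finite_leaders ne] by simp
  \<comment> \<open>The leader 0 guarantees that a second largest leader exists.\<close>
  have ne2: "?L - {Max ?L} \<noteq> {}"
    using zero_in_leaders u Max by auto
  then show second: "nth_largest_leader q n 2 = Max (?L - {?t})"
    using nth_largest_leader_2[OF finite_leaders ne] Max by simp
  have "Max (?L - {?t}) \<in> ?L - {?t}"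
    using ne2 finite_leaders Max by (intro Max_in) auto
  then show "nth_largest_leader q n 2 < ?t"
    using second Max_ge[OF finite_leaders] Max by fastforce
qed

text \<open>No leader lies strictly between the two largest ones, so for such
  \<open>\<delta>\<close> only 0 and one coset escape.\<close>

lemma card_complement_first:
  assumes u: "0 < u\<^sub>1" "u\<^sub>1 < n" and max: "\<forall>v\<in>C u\<^sub>1. v \<le> u\<^sub>1"
    and other: "\<forall>u. 0 < u \<and> u < n \<longrightarrow> u \<in> C u\<^sub>1 \<or> (\<exists>v\<in>C u. u\<^sub>1 < v)"
    and \<delta>: "nth_largest_leader q n 2 < \<delta>" "\<delta> \<le> nth_largest_leader q n 1"
  shows "card ({..<n} - (\<Union>j\<in>{1..\<delta> - 1}. C j)) = 1 + card (C u\<^sub>1)"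
proof -
  let ?L = "coset_leaders q n" and ?t = "n - u\<^sub>1"
  note first = first_leader[OF u max other]
  have "\<delta> \<le> leader t \<longleftrightarrow> t \<in> C ?t" if t: "t < n" for t
  proof -
    have "leader t \<le> nth_largest_leader q n 2" if "leader t \<noteq> ?t"
    proof -
      have "leader t \<in> ?L - {?t}"
        using that t by (auto simp: coset_leaders_eq)
      then show ?thesis
        unfolding first(2) using finite_leaders by (intro Max_ge) auto
    qed
    then have "\<delta> \<le> leader t \<longleftrightarrow> leader t = ?t"
      using \<delta> first(1) by linarith
    then show ?thesis
      using mem_coset_leader_iff[of ?t t] first(4) t u by simp
  qed
  then have "{t. t < n \<and> (t = 0 \<or> \<delta> \<le> leader t)} = insert 0 (C ?t)"
    using coset_subset[of ?t] u by auto
  moreover have "0 \<notin> C ?t"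
    using coset_pos[of ?t 0] u by auto
  moreover have "\<delta> \<le> n"
    using \<delta> first(1) by simp
  ultimately show ?thesis
    using u unfolding complement_cosets[OF \<open>\<delta> \<le> n\<close>] by (simp add: card_coset_negate)
qed

text \<open>The union stops at \<open>\<delta> - 1\<close>, so the coset led by the second leader
  itself escapes too.\<close>

lemma card_complement_second:
  assumes u1: "0 < u\<^sub>1" "u\<^sub>1 < u\<^sub>2" "u\<^sub>2 < n"
    and max1: "\<forall>v\<in>C u\<^sub>1. v \<le> u\<^sub>1" and max2: "\<forall>v\<in>C u\<^sub>2. v \<le> u\<^sub>2"
    and other: "\<forall>u. 0 < u \<and> u < n \<longrightarrow> u \<in> C u\<^sub>1 \<or> u \<in> C u\<^sub>2 \<or> (\<exists>v\<in>C u. u\<^sub>2 < v)"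
    and \<delta>: "\<delta> = nth_largest_leader q n 2"
  shows "card ({..<n} - (\<Union>j\<in>{1..\<delta> - 1}. C j)) = 1 + card (C u\<^sub>1) + card (C u\<^sub>2)"
proof -
  let ?L = "coset_leaders q n" and ?t1 = "n - u\<^sub>1" and ?t2 = "n - u\<^sub>2"
  have u: "u\<^sub>1 < n" "0 < u\<^sub>2"
    using u1 by auto
  have other1: "\<forall>u. 0 < u \<and> u < n \<longrightarrow> u \<in> C u\<^sub>1 \<or> (\<exists>v\<in>C u. u\<^sub>1 < v)"
    using other coset_sym[of u\<^sub>2] u1 by (meson less_trans)
  note first = first_leader[OF u1(1) u(1) max1 other1]
  have "Max (C u\<^sub>2) = u\<^sub>2"
    using max2 self_in_coset[OF u1(3)] by (intro Max_eqI) auto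
  then have lead: "leader ?t2 = ?t2"
    using leader_negate[OF u(2) u1(3)] by simp
  have cases: "leader t = ?t1 \<or> leader t \<le> ?t2" if t: "t < n" for t
  proof (cases "t = 0")
    case False
    then have t': "0 < n - t" "n - t < n"
      using t by auto
    consider "n - t \<in> C u\<^sub>1" | "n - t \<in> C u\<^sub>2" | "\<exists>v\<in>C (n - t). u\<^sub>2 < v"
      using other t' by blast
    then show ?thesis
    proof cases
      case 1
      then have "t \<in> C ?t1"
        using False t u u1 mem_coset_negate by simp
      then show ?thesis
        using coset_eq[of ?t1 t] first(4) u1 by simp
    next
      case 2
      then have "t \<in> C ?t2"
        using False t u u1 mem_coset_negate by simp
      then show ?thesis
        using coset_eq[of ?t2 t] lead u by simp
    next
      case 3
      then obtain v where "v \<in> C (n - t)" "u\<^sub>2 < v" by auto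
      then show ?thesis
        using leader_le_negate[of t v] False t by auto
    qed
  qed simp
  have "?t2 \<in> ?L - {?t1}"
    using lead u u1 unfolding coset_leaders_eq
    by (intro DiffI rev_image_eqI[of ?t2]) auto
  then have \<delta>_eq: "\<delta> = ?t2"
    unfolding \<delta> first(2) using cases finite_leaders
    by (intro Max_eqI) (auto simp: coset_leaders_eq)
  have "\<delta> \<le> leader t \<longleftrightarrow> t \<in> C ?t1 \<union> C ?t2" if t: "t < n" for t
  proof -
    have "\<delta> \<le> leader t \<longleftrightarrow> leader t = ?t1 \<or> leader t = ?t2"
      using cases[OF t] u1 \<delta>_eq by linarith
    then show ?thesis
      using mem_coset_leader_iff[of ?t1 t] mem_coset_leader_iff[of ?t2 t] lead first(4) t u u1 by simp
  qed
  then have "{t. t < n \<and> (t = 0 \<or> \<delta> \<le> leader t)} = insert 0 (C ?t1 \<union> C ?t2)"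
    using coset_subset[of ?t1] coset_subset[of ?t2] u u1 by auto
  moreover have "0 \<notin> C ?t1 \<union> C ?t2"
    using coset_pos[of ?t1 0] coset_pos[of ?t2 0] u u1 by auto
  moreover have "C ?t1 \<inter> C ?t2 = {}"
  proof -
    have "leader t = ?t1" "leader t = ?t2" if "t \<in> C ?t1" "t \<in> C ?t2" for t
      using coset_eq[OF _ that(1)] coset_eq[OF _ that(2)] lead first(4) u u1 by simp_all
    moreover have "?t1 \<noteq> ?t2"
      using u u1 by simp
    ultimately show ?thesis
      by fastforce
  qed
  moreover have "\<delta> \<le> n"
    using \<delta>_eq by simp
  ultimately show ?thesis
    using u u1 unfolding complement_cosets[OF \<open>\<delta> \<le> n\<close>]
    by (simp add: card_coset_negate card_Un_disjoint)
qed

text \<open>The coset of any element of \<open>C u\<^sub>2\<close> contains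
  \<open>u\<^sub>2\<close>, which already exceeds \<open>u\<^sub>1\<close>.\<close>

lemma other_cosets_first:
  assumes "u\<^sub>1 < u\<^sub>2" "u\<^sub>2 < n"
    and other: "\<forall>u. 0 < u \<and> u < n \<longrightarrow> u \<in> C u\<^sub>1 \<or> u \<in> C u\<^sub>2 \<or> (\<exists>v\<in>C u. u\<^sub>2 < v)"
  shows "\<forall>u. 0 < u \<and> u < n \<longrightarrow> u \<in> C u\<^sub>1 \<or> (\<exists>v\<in>C u. u\<^sub>1 < v)"
  using other coset_sym[of u\<^sub>2] assms(1,2) by (meson less_trans)

end

subsection \<open>Base-\<open>q\<close> digits and their rotations\<close>

text \<open>In base at least 3, two powers with exponents below \<open>z\<close> together stay below
  \<open>q ^ z\<close>. So the larger exponents agree, and cancelling them leaves a single power on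
  each side.\<close>

lemma power_sum_eq_iff:
  fixes q :: nat
  assumes q: "q \<ge> 3" and "a \<noteq> b" "c \<noteq> d" and eq: "q ^ a + q ^ b = q ^ c + q ^ d"
  shows "a = c \<and> b = d \<or> a = d \<and> b = c"
proof -
  have less: "q ^ x + q ^ y < q ^ z + q ^ w" if "x < z" "y < z" for x y z w
  proof -
    have "q ^ x \<le> q ^ (z - 1)" "q ^ y \<le> q ^ (z - 1)"
      using q that by (auto intro!: power_increasing)
    moreover have "3 * q ^ (z - 1) \<le> q ^ z"
      using q that by (cases z) auto
    moreover have "0 < q ^ (z - 1)"
      using q by simp
    ultimately show ?thesis
      by linarith
  qed
  have inj: "x = y" if "q ^ x = q ^ y" for x y
    using that q by simp
  have "max a b = max c d"
  proof (rule ccontr)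
    assume "max a b \<noteq> max c d"
    then consider "a < c" "b < c" | "a < d" "b < d" | "c < a" "d < a" | "c < b" "d < b"
      by linarith
    then show False
    proof cases
      case 1
      then show False using less[of a c b d] eq by simp
    next
      case 2
      then show False using less[of a d b c] eq by simp
    next
      case 3
      then show False using less[of c a d b] eq by simp
    next
      case 4
      then show False using less[of c b d a] eq by simp
    qed
  qed
  then consider "a = c" | "a = d" | "b = c" | "b = d"
    by linarith
  then show ?thesis
    using eq inj[of a c] inj[of a d] inj[of b c] inj[of b d] by cases simp_all
qed

section \<open>Words with two digits 1 and their cosets\<close>

locale bch_length =
  fixes q m n :: nat
  assumes q_ge_3: "q \<ge> 3" and m_ge_2: "m \<ge> 2" and even_m: "even m"
    and n_mult: "n * (q + 1) = q ^ m - 1"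
begin

text \<open>Multiplication by \<open>q\<close> modulo \<open>K\<close> rotates words of
  \<open>m\<close> digits in base \<open>q\<close>.\<close>

definition K :: nat where "K = q ^ m - 1"

lemma mult_n: "(q + 1) * n = K"
  using n_mult by (simp add: K_def mult.commute)

lemma K_pos: "K > 0" and q_pow_m_eq: "q ^ m = K + 1"
proof -
  have "q ^ 1 < q ^ m"
    using q_ge_3 m_ge_2 by (intro power_strict_increasing) auto
  then show "K > 0" "q ^ m = K + 1"
    using q_ge_3 by (auto simp: K_def)
qed

lemma cong_K: "[q ^ m = 1] (mod K)"
proof -
  have "[K + 1 = 0 + 1] (mod K)"
    by (intro cong_add cong_refl) (simp add: cong_def)
  then show ?thesis
    unfolding q_pow_m_eq by simp
qed

sublocale cyclotomic q n m
proof
  have "q ^ 2 \<le> q ^ m"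
    using q_ge_3 m_ge_2 by (intro power_increasing) auto
  moreover have "q * 3 \<le> q ^ 2"
    using q_ge_3 by (simp add: power2_eq_square)
  ultimately have "q * 3 \<le> K + 1"
    unfolding q_pow_m_eq by (rule order_trans[rotated])
  then have "(q + 1) * 1 < (q + 1) * n"
    unfolding mult_n using q_ge_3 by simp
  then show "n > 1"
    unfolding mult_less_cancel1 by simp
  show "m > 0"
    using m_ge_2 by simp
  have "n dvd K"
    by (metis dvd_triv_right mult_n)
  then show "[q ^ m = 1] (mod n)"
    by (rule cong_dvd_modulus_nat[OF cong_K])
qed

text \<open>Scaling by \<open>q + 1\<close> passes from residues modulo \<open>n\<close> to residues
  modulo \<open>K = (q + 1) * n\<close>, where cosets become sets of rotations.\<close>

lemma mult_coset_elem: "(q + 1) * (u * q ^ j mod n) = (q + 1) * u * q ^ j mod K"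
  using mult_mod_right[of "q + 1" "u * q ^ j" n] by (simp only: mult.assoc mult_n)

text \<open>The residue that corresponds to the word with digits 1 at positions \<open>a\<close> and
  \<open>b\<close>. The division is exact for odd \<open>a + b\<close>, hence the parity conditions
  below.\<close>

definition w :: "nat \<Rightarrow> nat \<Rightarrow> nat" where
  "w a b = (q ^ a + q ^ b) div (q + 1)"

lemma q_cong: "[int q = - 1] (mod int (q + 1))"
  by (simp add: cong_iff_dvd_diff add.commute)

text \<open>Modulo \<open>q + 1\<close> the base is -1, so powers with exponents of opposite parity
  cancel.\<close>

lemma dvd_power_sum:
  assumes "odd (a + b)"
  shows "q + 1 dvd q ^ a + q ^ b"
proof -
  have "[int q ^ a + int q ^ b = (-1) ^ a + (-1) ^ b] (mod int (q + 1))"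
    by (intro cong_add cong_pow q_cong)
  moreover have "(-1 :: int) ^ a + (-1) ^ b = 0"
    using assms by (cases "even a") auto
  ultimately have "int (q + 1) dvd int (q ^ a + q ^ b)"
    by (simp add: cong_0_iff)
  then show ?thesis
    by (simp only: int_dvd_int_iff)
qed

lemma mult_w: "odd (a + b) \<Longrightarrow> (q + 1) * w a b = q ^ a + q ^ b"
  unfolding w_def by (intro dvd_mult_div_cancel dvd_power_sum)

lemma power_sum_less_K:
  assumes "a < m" "b < m"
  shows "q ^ a + q ^ b < K"
proof -
  have "q ^ a \<le> q ^ (m - 1)" "q ^ b \<le> q ^ (m - 1)"
    using q_ge_3 assms by (auto intro!: power_increasing)
  moreover have "3 * q ^ (m - 1) \<le> q * q ^ (m - 1)"
    using q_ge_3 by simp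
  moreover have "q * q ^ (m - 1) = q ^ m"
    using m_ge_2 by (simp flip: power_Suc)
  moreover have "q ^ 1 \<le> q ^ (m - 1)"
    using q_ge_3 m_ge_2 by (intro power_increasing) auto
  ultimately show ?thesis
    using q_ge_3 q_pow_m_eq unfolding power_one_right by linarith
qed

text \<open>Exponents count only modulo \<open>m\<close>, and the resulting sum is below
  \<open>K\<close>, so the congruence is an equation of reduced residues.\<close>

lemma rotate_power_sum:
  "(q ^ a + q ^ b) * q ^ j mod K = q ^ ((a + j) mod m) + q ^ ((b + j) mod m)"
proof -
  have "[q ^ k = q ^ (k mod m)] (mod K)" for k
  proof -
    have "[(q ^ m) ^ (k div m) * q ^ (k mod m) = 1 ^ (k div m) * q ^ (k mod m)] (mod K)"
      by (intro cong_mult cong_pow cong_refl cong_K)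
    then show ?thesis
      by (simp flip: power_mult power_add)
  qed
  then have "[q ^ (a + j) + q ^ (b + j) = q ^ ((a + j) mod m) + q ^ ((b + j) mod m)] (mod K)"
    by (intro cong_add)
  moreover have "q ^ ((a + j) mod m) + q ^ ((b + j) mod m) < K"
    by (intro power_sum_less_K) (use m_pos in auto)
  ultimately show ?thesis
    unfolding distrib_right power_add[symmetric] by (simp only: cong_def mod_less)
qed

lemma w_pos:
  assumes "odd (a + b)"
  shows "0 < w a b"
proof -
  have "0 < (q + 1) * w a b"
    unfolding mult_w[OF assms] using q_ge_3 by simp
  then show ?thesis by (cases "w a b = 0") auto
qed

lemma w_less:
  assumes "odd (a + b)" "a < m" "b < m"
  shows "w a b < n"
proof -
  have "(q + 1) * w a b < (q + 1) * n"
    using mult_w[OF assms(1)] power_sum_less_K[OF assms(2,3)] mult_n by metis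
  then show ?thesis
    unfolding mult_less_cancel1 by simp
qed

lemma odd_rotate: "odd (a + b) \<Longrightarrow> odd ((a + j) mod m + (b + j) mod m)"
  using even_m by (metis dvd_mod_iff even_add)

lemma rotate_w:
  assumes "odd (a + b)"
  shows "w a b * q ^ j mod n = w ((a + j) mod m) ((b + j) mod m)"
proof -
  have "(q + 1) * (w a b * q ^ j mod n) = (q + 1) * w ((a + j) mod m) ((b + j) mod m)"
    unfolding mult_coset_elem mult_w[OF assms] mult_w[OF odd_rotate[OF assms]]
    by (rule rotate_power_sum)
  then show ?thesis
    unfolding mult_cancel1 by simp
qed

lemma coset_w: "odd (a + b) \<Longrightarrow> C (w a b) = (\<lambda>j. w ((a + j) mod m) ((b + j) mod m)) ` {..<m}"
  by (simp add: coset_eq_image rotate_w)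

lemma w_le:
  assumes "odd (a + b)" "odd (c + d)" "q ^ a + q ^ b \<le> q ^ c + q ^ d"
  shows "w a b \<le> w c d"
proof -
  have "(q + 1) * w a b \<le> (q + 1) * w c d"
    unfolding mult_w[OF assms(1)] mult_w[OF assms(2)] by (rule assms)
  then show ?thesis unfolding mult_le_cancel1 by simp
qed

text \<open>Only two rotations have a digit 1 at the top, with the other one \<open>g\<close> or
  \<open>m - g\<close> places below; since \<open>2 * g \<le> m\<close>, the first is the
  larger.\<close>

lemma coset_w_le:
  assumes g: "odd g" "2 * g \<le> m" and v: "v \<in> C (w (m - 1) (m - 1 - g))"
  shows "v \<le> w (m - 1) (m - 1 - g)"
proof -
  let ?b = "m - 1 - g"
  have odd: "odd (m - 1 + ?b)"
    using g even_m m_ge_2 by auto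
  obtain j where j: "j < m" "v = w ((m - 1 + j) mod m) ((?b + j) mod m)"
    using v unfolding coset_w[OF odd] by blast
  have "q ^ ((m - 1 + j) mod m) + q ^ ((?b + j) mod m) \<le> q ^ (m - 1) + q ^ ?b"
  proof (cases "j = 0")
    case True
    then show ?thesis using m_pos by simp
  next
    case False
    then have a: "(m - 1 + j) mod m = j - 1"
      using j m_pos by (simp add: mod_if)
    have b: "(?b + j) mod m = (if j \<le> g then ?b + j else j - 1 - g)"
      using j g m_pos by (auto simp: mod_if)
    show ?thesis
    \<comment> \<open>At \<open>j = g\<close> the second digit has moved to the top and the first
      one to position \<open>g - 1\<close>, at most \<open>m - 1 - g\<close>.\<close>
    proof (cases "j = g")
      case True
      then have "q ^ (j - 1) \<le> q ^ ?b"
        using g q_ge_3 by (intro power_increasing) auto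
      moreover have "?b + g = m - 1"
        using g by simp
      ultimately show ?thesis
        unfolding a b using True by simp
    next
      case False
      \<comment> \<open>The top position is now empty, and two powers of exponent at most
        \<open>m - 2\<close> cannot exceed \<open>q ^ (m - 1)\<close>.\<close>
      have "q ^ (j - 1) \<le> q ^ (m - 2)"
        using j q_ge_3 by (intro power_increasing) auto
      moreover have "q ^ ((?b + j) mod m) \<le> q ^ (m - 2)"
        unfolding b using j g False q_ge_3 by (intro power_increasing) auto
      moreover have "2 * q ^ (m - 2) \<le> q ^ (m - 1)"
      proof -
        have "q ^ (m - 1) = q * q ^ (m - 2)"
          using m_ge_2 by (simp flip: power_Suc add: Suc_diff_Suc numeral_2_eq_2)
        then show ?thesis using q_ge_3 by simp
      qed
      ultimately show ?thesis
        unfolding a by linarith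
    qed
  qed
  then show ?thesis
    unfolding j by (intro w_le odd_rotate odd)
qed

lemma w_eq_iff:
  assumes "odd (a + b)" "odd (c + d)" "w a b = w c d"
  shows "a = c \<and> b = d \<or> a = d \<and> b = c"
proof -
  have "q ^ a + q ^ b = q ^ c + q ^ d"
    using mult_w[OF assms(1)] mult_w[OF assms(2)] assms(3) by simp
  moreover have "a \<noteq> b" "c \<noteq> d"
    using assms by auto
  ultimately show ?thesis
    using power_sum_eq_iff[OF q_ge_3] by blast
qed

text \<open>Two different rotations could agree only by exchanging the two digits 1. Adding the two
  congruences of such an exchange gives \<open>m dvd 2 * g\<close>, against
  \<open>2 * g < m\<close>.\<close>

lemma card_coset_w:
  assumes g: "odd g" "2 * g < m"
  shows "card (C (w (m - 1) (m - 1 - g))) = m"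
proof -
  let ?b = "m - 1 - g"
  have odd: "odd (m - 1 + ?b)"
    using g even_m m_ge_2 by auto
  have "inj_on (\<lambda>j. w ((m - 1 + j) mod m) ((?b + j) mod m)) {..<m}"
  proof (rule inj_onI)
    fix i j assume ij: "i \<in> {..<m}" "j \<in> {..<m}"
      and eq: "w ((m - 1 + i) mod m) ((?b + i) mod m) = w ((m - 1 + j) mod m) ((?b + j) mod m)"
    consider "(m - 1 + i) mod m = (m - 1 + j) mod m"
      | "(m - 1 + i) mod m = (?b + j) mod m" "(?b + i) mod m = (m - 1 + j) mod m"
      using w_eq_iff[OF odd_rotate[OF odd] odd_rotate[OF odd] eq] by blast
    then show "i = j"
    proof cases
      case 1
      then have "[m - 1 + i = m - 1 + j] (mod m)"
        by (simp add: cong_def)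
      then have "[i = j] (mod m)"
        unfolding cong_add_lcancel_nat .
      then show ?thesis
        using ij by (simp add: cong_def)
    next
      case 2
      then have "[m - 1 + i = ?b + j] (mod m)" "[?b + i = m - 1 + j] (mod m)"
        by (simp_all add: cong_def)
      then have "[(m - 1 + i) + (m - 1 + j) = (?b + j) + (?b + i)] (mod m)"
        using cong_add cong_sym by blast
      moreover have "(m - 1 + i) + (m - 1 + j) = (?b + j) + (?b + i) + 2 * g"
        using g by auto
      ultimately have "[(?b + j) + (?b + i) + 2 * g = (?b + j) + (?b + i) + 0] (mod m)"
        by (metis add_0_right)
      then have "[2 * g = 0] (mod m)"
        unfolding cong_add_lcancel_nat .
      then have "m dvd 2 * g"
        by (simp add: cong_0_iff)
      then show ?thesis
        using g by (auto dest: dvd_imp_le)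
    qed
  qed
  then show ?thesis
    unfolding coset_w[OF odd] by (simp only: card_image card_lessThan)
qed

end

section \<open>Digit words of arbitrary residues\<close>

locale rotations = bch_length +
  fixes E :: nat
  assumes E_less: "E < K" and dvd_E: "q + 1 dvd E"
begin

text \<open>Long division of \<open>E\<close> by \<open>K\<close> in base \<open>q\<close>:
  \<open>e j\<close> are the remainders, and \<open>c j\<close> the digits of the purely periodic
  expansion of \<open>E / K\<close>.\<close>

definition e :: "nat \<Rightarrow> nat" where "e j = E * q ^ j mod K"
definition c :: "nat \<Rightarrow> nat" where "c j = q * e j div K"

lemma e_0: "e 0 = E"
  using E_less by (simp add: e_def)

lemma e_less: "e j < K"
  using K_pos by (simp add: e_def)

lemma e_step: "q * e j = K * c j + e (Suc j)"
proof -
  have "e (Suc j) = q * e j mod K"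
    by (simp add: e_def mod_mult_right_eq mult_ac)
  then show ?thesis
    by (simp add: c_def)
qed

lemma e_add: "e (i + j) = e i * q ^ j mod K"
  by (simp add: e_def mod_mult_left_eq mult.assoc flip: power_add)

lemma e_period: "e (j + m) = e j"
proof -
  have "[e j * q ^ m = e j * 1] (mod K)"
    by (intro cong_mult cong_refl cong_K)
  then show ?thesis
    using e_less[of j] by (simp add: e_add cong_def)
qed

lemma c_period: "c (j + m) = c j"
  by (simp add: c_def e_period)

text \<open>Long division carried through \<open>l\<close> steps. At \<open>l = m\<close> the
  remainder has returned to \<open>e j\<close>, and \<open>q ^ m = K + 1\<close> yields the digit
  expansion.\<close>

lemma e_expand: "q ^ l * e j = e (j + l) + K * (\<Sum>i<l. c (j + i) * q ^ (l - 1 - i))"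
proof (induction l)
  case (Suc l)
  have "q ^ Suc l * e j = q * (q ^ l * e j)"
    by simp
  also have "\<dots> = q * e (j + l) + K * (\<Sum>i<l. q * (c (j + i) * q ^ (l - 1 - i)))"
    unfolding Suc.IH by (simp add: distrib_left sum_distrib_left mult.left_commute)
  also have "(\<Sum>i<l. q * (c (j + i) * q ^ (l - 1 - i))) = (\<Sum>i<l. c (j + i) * q ^ (l - i))"
  proof (rule sum.cong)
    fix i assume "i \<in> {..<l}"
    then have "q ^ (l - i) = q * q ^ (l - 1 - i)"
      by (simp flip: power_Suc add: Suc_diff_Suc)
    then show "q * (c (j + i) * q ^ (l - 1 - i)) = c (j + i) * q ^ (l - i)"
      by simp
  qed simp
  finally show ?case
    by (simp add: e_step distrib_left)
qed simp

text \<open>The quotients \<^term>\<open>c j\<close> are the base-\<^term>\<open>q\<close> digits, and passing from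
  \<^term>\<open>e j\<close> to \<^term>\<open>e (Suc j)\<close> rotates them cyclically.\<close>

lemma e_digits: "e j = (\<Sum>i<m. c (j + i) * q ^ (m - 1 - i))"
proof -
  have "q ^ m * e j = e j + K * (\<Sum>i<m. c (j + i) * q ^ (m - 1 - i))"
    using e_expand[of m j] by (simp add: e_period)
  moreover have "q ^ m * e j = e j + K * e j"
    by (subst q_pow_m_eq) simp
  ultimately show ?thesis
    using K_pos by simp
qed

lemma dvd_e: "q + 1 dvd e j"
proof -
  have "q + 1 dvd K"
    by (metis dvd_triv_left mult_n)
  then show ?thesis
    using dvd_E by (simp add: e_def dvd_mod)
qed

text \<open>Substituting -1 for \<open>q\<close> in the digit expansion gives the alternating digit
  sum, up to a global sign because the top exponent \<open>m - 1\<close> is odd.\<close>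

lemma dvd_alternating: "int (q + 1) dvd (\<Sum>i<m. int (c (j + i)) * (-1) ^ i)"
proof -
  have "[int (e j) = (\<Sum>i<m. int (c (j + i)) * (-1) ^ (m - 1 - i))] (mod int (q + 1))"
    unfolding e_digits of_nat_sum of_nat_mult of_nat_power
    by (intro cong_sum cong_mult cong_refl cong_pow q_cong)
  also have "(\<Sum>i<m. int (c (j + i)) * (-1) ^ (m - 1 - i)) = - (\<Sum>i<m. int (c (j + i)) * (-1) ^ i)"
    unfolding sum_negf[symmetric]
  proof (rule sum.cong)
    fix i assume "i \<in> {..<m}"
    then show "int (c (j + i)) * (-1) ^ (m - 1 - i) = - (int (c (j + i)) * (-1) ^ i)"
      using even_m by (cases "even i") auto
  qed simp
  finally have "int (q + 1) dvd int (e j) \<longleftrightarrow>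
      int (q + 1) dvd - (\<Sum>i<m. int (c (j + i)) * (-1) ^ i)"
    by (rule cong_dvd_iff)
  then show ?thesis
    using dvd_e[of j] unfolding int_dvd_int_iff dvd_minus_iff by blast
qed

lemma e_ge_two:
  assumes "0 < c j" "0 < c (j + i)" "0 < i" "i < m"
  shows "q ^ (m - 1) + q ^ (m - 1 - i) \<le> e j"
proof -
  have "(\<Sum>k\<in>{0,i}. c (j + k) * q ^ (m - 1 - k)) \<le> e j"
    unfolding e_digits using assms by (intro sum_mono2) auto
  then have "c j * q ^ (m - 1) + c (j + i) * q ^ (m - 1 - i) \<le> e j"
    using assms by simp
  moreover have "q ^ (m - 1) \<le> c j * q ^ (m - 1)" "q ^ (m - 1 - i) \<le> c (j + i) * q ^ (m - 1 - i)"
    using assms by auto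
  ultimately show ?thesis
    by linarith
qed

lemma ex_digit:
  assumes "E > 0"
  shows "\<exists>j. c j > 0"
proof (rule ccontr)
  assume "\<not> (\<exists>j. c j > 0)"
  then have "e 0 = 0"
    by (simp add: e_digits)
  then show False
    using assms e_0 by simp
qed

lemma digit_le_1:
  assumes "\<And>j. e j < 2 * q ^ (m - 1)"
  shows "c j \<le> 1"
proof -
  have "q * e j < 2 * K"
  proof -
    \<comment> \<open>The 1 gained from the strict bound becomes a summand \<open>q \<ge> 3\<close>,
      which outweighs the 2 in \<open>2 * q ^ m = 2 * K + 2\<close>.\<close>
    have "e j + 1 \<le> 2 * q ^ (m - 1)"
      using assms[of j] by simp
    then have "q * (e j + 1) \<le> q * (2 * q ^ (m - 1))"
      by (intro mult_le_mono2)
    also have "\<dots> = 2 * q ^ m"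
      using m_ge_2 by (simp flip: power_Suc)
    finally show ?thesis
      using q_ge_3 q_pow_m_eq by simp
  qed
  then have "c j < 2"
    using K_pos by (simp add: c_def less_mult_imp_div_less mult.commute)
  then show ?thesis by simp
qed

text \<open>Two digits 1 at distance at most \<open>g\<close> could be rotated so that the first is
  at the top, which gives at least the forbidden word. The bound comes in two halves since
  \<open>le\<close> expresses maximality and \<open>ne\<close> membership in a different
  coset.\<close>

lemma sparse_digits:
  assumes g: "0 < g" "g < m"
    and le: "\<And>j. e j \<le> q ^ (m - 1) + q ^ (m - 1 - g)"
    and ne: "\<And>j. e j \<noteq> q ^ (m - 1) + q ^ (m - 1 - g)"
  shows "c j \<le> 1" and "c j = 1 \<Longrightarrow> 0 < i \<Longrightarrow> i \<le> g \<Longrightarrow> c (j + i) = 0"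
proof -
  have "q ^ (m - 1 - g) < q ^ (m - 1)"
    using q_ge_3 g by (intro power_strict_increasing) auto
  then have "e j < 2 * q ^ (m - 1)" for j
    using le[of j] by linarith
  then show "c j \<le> 1"
    by (rule digit_le_1)
  assume i: "c j = 1" "0 < i" "i \<le> g"
  have "q ^ (m - 1 - g) \<le> q ^ (m - 1 - i)"
    using i q_ge_3 by (intro power_increasing) auto
  then show "c (j + i) = 0"
    using e_ge_two[of j i] le[of j] ne[of j] i g by fastforce
qed

end

subsection \<open>The cosets with the largest leaders\<close>

lemma sum_lessThan_6: "(\<Sum>i<6. f i) = f 0 + f 1 + f 2 + f 3 + f 4 + f (5::nat)"
  for f :: "nat \<Rightarrow> 'a::comm_monoid_add"
  by (simp add: eval_nat_numeral)

lemma sum_lessThan_8: "(\<Sum>i<8. f i) = f 0 + f 1 + f 2 + f 3 + f 4 + f 5 + f 6 + f (7::nat)"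
  for f :: "nat \<Rightarrow> 'a::comm_monoid_add"
  by (simp add: eval_nat_numeral)

lemma sum_lessThan_12: "(\<Sum>i<12. f i) =
    f 0 + f 1 + f 2 + f 3 + f 4 + f 5 + f 6 + f 7 + f 8 + f 9 + f 10 + f (11::nat)"
  for f :: "nat \<Rightarrow> 'a::comm_monoid_add"
  by (simp add: eval_nat_numeral)

context bch_length begin

lemma w_commute: "w a b = w b a"
  by (simp add: w_def add.commute)

lemma w_strict:
  assumes "odd (a + b)" "odd (a + c)" "b < c"
  shows "w a b < w a c"
proof -
  have "q ^ b < q ^ c"
    using assms q_ge_3 by (intro power_strict_increasing) auto
  then have "(q + 1) * w a b < (q + 1) * w a c"
    unfolding mult_w[OF assms(1)] mult_w[OF assms(2)] by simp
  then show ?thesis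
    unfolding mult_less_cancel1 by simp
qed

text \<open>The alternating sums of the sparse words below are at most \<open>q\<close> in absolute
  value, so divisibility by \<open>q + 1\<close> turns into an equation.\<close>

lemma alternating_eq_0:
  assumes "int (q + 1) dvd x" "\<bar>x\<bar> \<le> int q"
  shows "x = 0"
  using assms dvd_imp_le_int[of x "int (q + 1)"] by fastforce

text \<open>The word is read from a digit 1 onwards. The last clause is the gap condition across the
  cyclic boundary, where position \<open>m - i\<close> lies \<open>i\<close> places before the
  leading digit.\<close>

definition gap_digits :: "nat \<Rightarrow> (nat \<Rightarrow> nat) \<Rightarrow> bool" where
  "gap_digits g d \<longleftrightarrow> d 0 = 1 \<and> (\<forall>i. d i \<le> 1) \<and>
     (\<forall>i k. d i = 1 \<and> 0 < k \<and> k \<le> g \<longrightarrow> d (i + k) = 0) \<and> (\<forall>i. 0 < i \<and> i \<le> g \<longrightarrow> d (m - i) = 0)"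

text \<open>The gap condition in the form of linear inequalities, from which linear arithmetic
  decides the digit patterns.\<close>

lemma gap_digitsD:
  assumes "gap_digits g d"
  shows "d 0 = 1" "d i \<le> 1" "0 < k \<Longrightarrow> k \<le> g \<Longrightarrow> d i + d (i + k) \<le> 1"
    "0 < k \<Longrightarrow> k \<le> g \<Longrightarrow> d k = 0" "0 < k \<Longrightarrow> k \<le> g \<Longrightarrow> d (m - k) = 0"
proof -
  note gap = assms[unfolded gap_digits_def]
  show "d 0 = 1" "d i \<le> 1" "0 < k \<Longrightarrow> k \<le> g \<Longrightarrow> d (m - k) = 0"
    using gap by simp_all
  show "d i + d (i + k) \<le> 1" if "0 < k" "k \<le> g"
  proof (cases "d i = 1")
    case True
    then show ?thesis
      using gap that by simp
  next
    case False
    moreover have "d i \<le> 1" "d (i + k) \<le> 1"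
      using gap by blast+
    ultimately show ?thesis by simp
  qed
  show "d k = 0" if "0 < k" "k \<le> g"
    using gap that by (metis add_0)
qed

text \<open>A coset that stays within the bound without being the bounding coset never attains it,
  so \<open>sparse_digits\<close> applies. As \<open>u > 0\<close>, some digit is nonzero, and the
  word is rotated to start there.\<close>

lemma small_rotations:
  assumes u: "0 < u" "u < n" and g: "odd g" "g < m"
    and max: "\<forall>v\<in>C u. v \<le> w (m - 1) (m - 1 - g)" and notin: "u \<notin> C (w (m - 1) (m - 1 - g))"
  shows "\<exists>d. gap_digits g d \<and> int (q + 1) dvd (\<Sum>i<m. int (d i) * (-1) ^ i) \<and>
    (\<exists>v\<in>C u. (q + 1) * v = (\<Sum>i<m. d i * q ^ (m - 1 - i)))"
proof -
  have "(q + 1) * u < K"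
    unfolding mult_n[symmetric] mult_less_cancel1 using u by simp
  then interpret rotations q m n "(q + 1) * u"
    by unfold_locales (assumption, rule dvd_triv_left)
  have e_eq: "e j = (q + 1) * (u * q ^ j mod n)" for j
    unfolding e_def mult_coset_elem ..
  have odd: "odd (m - 1 + (m - 1 - g))"
    using g even_m m_ge_2 by auto
  have le: "e j \<le> q ^ (m - 1) + q ^ (m - 1 - g)" for j
    using max cosetI[of u j] unfolding e_eq mult_w[OF odd, symmetric]
    by (intro mult_le_mono2) (simp add: not_less)
  have ne: "e j \<noteq> q ^ (m - 1) + q ^ (m - 1 - g)" for j
  proof
    assume "e j = q ^ (m - 1) + q ^ (m - 1 - g)"
    then have "u * q ^ j mod n = w (m - 1) (m - 1 - g)"
      unfolding e_eq mult_w[OF odd, symmetric] mult_cancel1 by simp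
    then show False
      using notin coset_sym[OF u(2) cosetI[of u j]] by simp
  qed
  have g0: "0 < g"
    using g by (auto intro: Nat.gr0I)
  note sparse = sparse_digits[OF g0 g(2) le ne]
  have "(q + 1) * u > 0"
    using u by simp
  then obtain j where "c j > 0"
    using ex_digit by blast
  then have j: "c j = 1"
    using sparse(1)[of j] by simp
  have "gap_digits g (\<lambda>i. c (j + i))"
    unfolding gap_digits_def
  proof (intro conjI allI impI)
    show "c (j + 0) = 1" "c (j + i) \<le> 1" for i
      using j sparse(1) by simp_all
    show "c (j + (i + k)) = 0" if "c (j + i) = 1 \<and> 0 < k \<and> k \<le> g" for i k
      using sparse(2)[of "j + i" k] that by (simp add: add.assoc)
    \<comment> \<open>A digit 1 here would force a 0 at position \<open>j + m\<close>, which by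
      periodicity carries the leading digit 1.\<close>
    show "c (j + (m - i)) = 0" if i: "0 < i \<and> i \<le> g" for i
    proof (rule ccontr)
      assume "c (j + (m - i)) \<noteq> 0"
      then have "c (j + (m - i)) = 1"
        using sparse(1)[of "j + (m - i)"] by simp
      then have "c (j + (m - i) + i) = 0"
        using i by (intro sparse(2)) auto
      moreover have "j + (m - i) + i = j + m"
        using i g by simp
      ultimately show False
        using j c_period[of j] by simp
    qed
  qed
  moreover have "(q + 1) * (u * q ^ j mod n) = (\<Sum>i<m. c (j + i) * q ^ (m - 1 - i))"
    unfolding e_eq[symmetric] by (rule e_digits)
  ultimately show ?thesis
    using dvd_alternating[of j] cosetI[of u j] by blast
qed

lemma mem_coset_wI:
  assumes "u < n" "v \<in> C u" "(q + 1) * v = q ^ a + q ^ b" "odd (a + b)"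
  shows "u \<in> C (w a b)"
proof -
  have "(q + 1) * v = (q + 1) * w a b"
    using assms mult_w by simp
  then have "v = w a b"
    unfolding mult_cancel1 by simp
  then show ?thesis
    using coset_sym[OF assms(1,2)] by simp
qed

lemma coset_w_rotate:
  assumes "odd (a + b)" "a < m" "b < m"
  shows "C (w ((a + j) mod m) ((b + j) mod m)) = C (w a b)"
  using coset_eq[OF w_less[OF assms] cosetI[of "w a b" j]] rotate_w[OF assms(1)] by simp

text \<open>Excluding distance 1 leaves digits 2, 3 and 4 free. Their alternating sum with the
  leading digit is at most 3, hence 0, which only the word \<open>100100\<close> achieves.\<close>

lemma cosets_6:
  assumes m: "m = 6" and u: "0 < u" "u < n"
  shows "u \<in> C (w 5 2) \<or> u \<in> C (w 5 4) \<or> (\<exists>v\<in>C u. w 5 4 < v)"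
proof (rule ccontr)
  assume not: "\<not> ?thesis"
  then obtain d v where d: "gap_digits 1 d" "v \<in> C u"
    "int (q + 1) dvd (\<Sum>i<6. int (d i) * (-1) ^ i)" "(q + 1) * v = (\<Sum>i<6. d i * q ^ (5 - i))"
    using small_rotations[OF u, of 1] by (simp add: m not_less) blast
  note gap = gap_digitsD[OF d(1)]
  have z: "d 1 = 0" "d 5 = 0"
    using gap(4)[of 1] gap(5)[of 1] by (simp_all add: m)
  have adj: "d i + d (i + 1) \<le> 1" for i
    by (rule gap(3)) auto
  note bounds = gap(2)[of 2] gap(2)[of 3] gap(2)[of 4] adj[of 2, simplified] adj[of 3, simplified]
  have "int (q + 1) dvd 1 + int (d 2) - int (d 3) + int (d 4)"
    using d(3) gap(1) z unfolding sum_lessThan_6 by simp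
  then have "1 + int (d 2) - int (d 3) + int (d 4) = 0"
    by (rule alternating_eq_0) (use bounds q_ge_3 in linarith)
  then have "d 2 = 0" "d 3 = 1" "d 4 = 0"
    using bounds by linarith+
  then have "(q + 1) * v = q ^ 5 + q ^ 2"
    unfolding d(4) sum_lessThan_6 using gap(1) z by simp
  then show False
    using not mem_coset_wI[OF u(2) d(2), of 5 2] by simp
qed

text \<open>Excluding distances up to 3 leaves only digit 4 free; it has the sign of the leading
  digit, so the sum is 1 or 2. This argument includes \<open>q = 3\<close>, where
  \<open>cosets_8\<close> fails.\<close>

lemma cosets_8_first:
  assumes m: "m = 8" and u: "0 < u" "u < n"
  shows "u \<in> C (w 7 4) \<or> (\<exists>v\<in>C u. w 7 4 < v)"
proof (rule ccontr)
  assume not: "\<not> ?thesis"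
  then obtain d v where d: "gap_digits 3 d" "v \<in> C u"
    "int (q + 1) dvd (\<Sum>i<8. int (d i) * (-1) ^ i)" "(q + 1) * v = (\<Sum>i<8. d i * q ^ (7 - i))"
    using small_rotations[OF u, of 3] by (simp add: m not_less) blast
  note gap = gap_digitsD[OF d(1)]
  have z: "d 1 = 0" "d 2 = 0" "d 3 = 0" "d 5 = 0" "d 6 = 0" "d 7 = 0"
    using gap(4)[of 1] gap(4)[of 2] gap(4)[of 3] gap(5)[of 1] gap(5)[of 2] gap(5)[of 3]
    by (simp_all add: m)
  have "int (q + 1) dvd 1 + int (d 4)"
    using d(3) gap(1) z unfolding sum_lessThan_8 by simp
  then have "1 + int (d 4) = 0"
    by (rule alternating_eq_0) (use gap(2)[of 4] q_ge_3 in linarith)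
  then show False by simp
qed

text \<open>The alternating sum can be as large as 4, and \<open>q > 3\<close> is what keeps it
  below \<open>q + 1\<close>.\<close>

lemma cosets_8:
  assumes m: "m = 8" and u: "0 < u" "u < n" and q: "q > 3"
  shows "u \<in> C (w 7 4) \<or> u \<in> C (w 7 6) \<or> (\<exists>v\<in>C u. w 7 6 < v)"
proof (rule ccontr)
  assume not: "\<not> ?thesis"
  then obtain d v where d: "gap_digits 1 d" "v \<in> C u"
    "int (q + 1) dvd (\<Sum>i<8. int (d i) * (-1) ^ i)" "(q + 1) * v = (\<Sum>i<8. d i * q ^ (7 - i))"
    using small_rotations[OF u, of 1] by (simp add: m not_less) blast
  note gap = gap_digitsD[OF d(1)]
  have z: "d 1 = 0" "d 7 = 0"
    using gap(4)[of 1] gap(5)[of 1] by (simp_all add: m)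
  have adj: "d i + d (i + 1) \<le> 1" for i
    by (rule gap(3)) auto
  note bounds = gap(2)[of 2] gap(2)[of 3] gap(2)[of 4] gap(2)[of 5] gap(2)[of 6]
    adj[of 2, simplified] adj[of 3, simplified] adj[of 4, simplified] adj[of 5, simplified]
  have "int (q + 1) dvd 1 + int (d 2) - int (d 3) + int (d 4) - int (d 5) + int (d 6)"
    using d(3) gap(1) z unfolding sum_lessThan_8 by simp
  then have eq: "1 + int (d 2) - int (d 3) + int (d 4) - int (d 5) + int (d 6) = 0"
    by (rule alternating_eq_0) (use bounds q in linarith)
  \<comment> \<open>If both \<open>d 3\<close> and \<open>d 5\<close> were 1, their neighbours would
    vanish and the sum would be -1.\<close>
  have zero: "d 2 = 0" "d 4 = 0" "d 6 = 0" "d 3 + d 5 = 1"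
    using eq bounds by linarith+
  then consider "d 3 = 1" "d 5 = 0" | "d 3 = 0" "d 5 = 1"
    by linarith
  then show False
  proof cases
    case 1
    then have "(q + 1) * v = q ^ 7 + q ^ 4"
      unfolding d(4) sum_lessThan_8 using gap(1) z zero by simp
    then show False
      using not mem_coset_wI[OF u(2) d(2), of 7 4] by simp
  next
    case 2
    then have "(q + 1) * v = q ^ 7 + q ^ 2"
      unfolding d(4) sum_lessThan_8 using gap(1) z zero by simp
    then have "u \<in> C (w 7 2)"
      using mem_coset_wI[OF u(2) d(2), of 7 2] by simp
    then show False
      \<comment> \<open>Distances 5 and 3 coincide on a cycle of 8 positions: rotation by 3 moves
        positions 7 and 4 to 2 and 7.\<close>
      using not coset_w_rotate[of 7 4 3] by (simp add: m w_commute)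
  qed
qed

text \<open>Excluding distances up to 3 leaves digits 4 to 8 free. Among the positive ones only 4
  and 8 can both be 1, so the sum is at most 3; the negative digits 5 and 7 exclude each other, so
  exactly one of them balances the leading digit.\<close>

lemma cosets_12:
  assumes m: "m = 12" and u: "0 < u" "u < n"
  shows "u \<in> C (w 11 6) \<or> u \<in> C (w 11 8) \<or> (\<exists>v\<in>C u. w 11 8 < v)"
proof (rule ccontr)
  assume not: "\<not> ?thesis"
  then obtain d v where d: "gap_digits 3 d" "v \<in> C u"
    "int (q + 1) dvd (\<Sum>i<12. int (d i) * (-1) ^ i)" "(q + 1) * v = (\<Sum>i<12. d i * q ^ (11 - i))"
    using small_rotations[OF u, of 3] by (simp add: m not_less) blast
  note gap = gap_digitsD[OF d(1)]
  have z: "d 1 = 0" "d 2 = 0" "d 3 = 0" "d 9 = 0" "d 10 = 0" "d 11 = 0"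
    using gap(4)[of 1] gap(4)[of 2] gap(4)[of 3] gap(5)[of 1] gap(5)[of 2] gap(5)[of 3]
    by (simp_all add: m)
  have near: "0 < k \<Longrightarrow> k \<le> 3 \<Longrightarrow> d i + d (i + k) \<le> 1" for i k
    by (rule gap(3))
  note bounds = gap(2)[of 4] gap(2)[of 5] gap(2)[of 6] gap(2)[of 7] gap(2)[of 8]
    near[of 1 4, simplified] near[of 2 4, simplified] near[of 3 4, simplified]
    near[of 1 5, simplified] near[of 2 5, simplified] near[of 3 5, simplified]
    near[of 1 6, simplified] near[of 2 6, simplified] near[of 1 7, simplified]
  have "int (q + 1) dvd 1 + int (d 4) - int (d 5) + int (d 6) - int (d 7) + int (d 8)"
    using d(3) gap(1) z unfolding sum_lessThan_12 by simp
  then have eq: "1 + int (d 4) - int (d 5) + int (d 6) - int (d 7) + int (d 8) = 0"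
    by (rule alternating_eq_0) (use bounds q_ge_3 in linarith)
  have zero: "d 4 = 0" "d 6 = 0" "d 8 = 0" "d 5 + d 7 = 1"
    using eq bounds by linarith+
  then consider "d 5 = 1" "d 7 = 0" | "d 5 = 0" "d 7 = 1"
    by linarith
  then show False
  proof cases
    case 1
    then have "(q + 1) * v = q ^ 11 + q ^ 6"
      unfolding d(4) sum_lessThan_12 using gap(1) z zero by simp
    then show False
      using not mem_coset_wI[OF u(2) d(2), of 11 6] by simp
  next
    case 2
    then have "(q + 1) * v = q ^ 11 + q ^ 4"
      unfolding d(4) sum_lessThan_12 using gap(1) z zero by simp
    then have "u \<in> C (w 11 4)"
      using mem_coset_wI[OF u(2) d(2), of 11 4] by simp
    then show False
      \<comment> \<open>Distances 7 and 5 coincide on a cycle of 12 positions: rotation by 5 moves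
        positions 11 and 6 to 4 and 11.\<close>
      using not coset_w_rotate[of 11 6 5] by (simp add: m w_commute)
  qed
qed

text \<open>Distance 3 is half the word length, so rotation by 3 exchanges the two digits 1 and the
  coset has only half the full size.\<close>

lemma card_coset_w_6:
  assumes m: "m = 6"
  shows "card (C (w 5 2)) = 3"
proof -
  have "{..<6::nat} = {0, 1, 2, 3, 4, 5}"
    by auto
  then have "C (w 5 2) = {w 5 2, w 0 3, w 1 4, w 2 5, w 3 0, w 4 1}"
    using coset_w[of 5 2] by (simp add: m flip: numeral_2_eq_2)
  then have "C (w 5 2) = {w 5 2, w 3 0, w 4 1}"
    unfolding w_commute[of 0 3] w_commute[of 1 4] w_commute[of 2 5] by auto
  moreover have "w 5 2 \<noteq> w 3 0" "w 5 2 \<noteq> w 4 1" "w 3 0 \<noteq> w 4 1"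
    using w_eq_iff[of 5 2 3 0] w_eq_iff[of 5 2 4 1] w_eq_iff[of 3 0 4 1] by auto
  ultimately show ?thesis by simp
qed

section \<open>Counting the residues outside the cosets\<close>

abbreviation uncovered :: "nat \<Rightarrow> nat" where
  "uncovered \<delta> \<equiv> card ({..<n} - (\<Union>j\<in>{1..\<delta> - 1}. C j))"

lemma uncovered_first:
  assumes g: "odd g" "2 * g \<le> m"
    and other: "\<forall>u. 0 < u \<and> u < n \<longrightarrow> u \<in> C (w (m - 1) (m - 1 - g)) \<or> (\<exists>v\<in>C u. w (m - 1) (m - 1 - g) < v)"
  shows "nth_largest_leader q n 2 < \<delta> \<Longrightarrow> \<delta> \<le> nth_largest_leader q n 1 \<Longrightarrow>
      uncovered \<delta> = 1 + card (C (w (m - 1) (m - 1 - g)))"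
    and "nth_largest_leader q n 1 \<le> n" and "nth_largest_leader q n 2 \<le> n"
proof -
  have odd: "odd (m - 1 + (m - 1 - g))"
    using g even_m m_ge_2 by auto
  have less: "w (m - 1) (m - 1 - g) < n"
    by (rule w_less[OF odd]) (use m_ge_2 in auto)
  have max: "\<forall>v\<in>C (w (m - 1) (m - 1 - g)). v \<le> w (m - 1) (m - 1 - g)"
    using coset_w_le[OF g] by blast
  show "nth_largest_leader q n 2 < \<delta> \<Longrightarrow> \<delta> \<le> nth_largest_leader q n 1 \<Longrightarrow>
      uncovered \<delta> = 1 + card (C (w (m - 1) (m - 1 - g)))"
    by (rule card_complement_first[OF w_pos[OF odd] less max other])
  show "nth_largest_leader q n 1 \<le> n" "nth_largest_leader q n 2 \<le> n"
    using first_leader(1,3)[OF w_pos[OF odd] less max other] by simp_all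
qed

text \<open>A smaller distance raises the lower digit 1, so distance \<open>h\<close> gives the
  larger maximum and thus the smaller leader.\<close>

lemma uncovered_second:
  assumes g: "odd g" "2 * g \<le> m" "odd h" "h < g"
    and other: "\<forall>u. 0 < u \<and> u < n \<longrightarrow> u \<in> C (w (m - 1) (m - 1 - g)) \<or>
      u \<in> C (w (m - 1) (m - 1 - h)) \<or> (\<exists>v\<in>C u. w (m - 1) (m - 1 - h) < v)"
  shows "nth_largest_leader q n 2 < \<delta> \<Longrightarrow> \<delta> \<le> nth_largest_leader q n 1 \<Longrightarrow>
      uncovered \<delta> = 1 + card (C (w (m - 1) (m - 1 - g)))"
    and "uncovered (nth_largest_leader q n 2) =
      1 + card (C (w (m - 1) (m - 1 - g))) + card (C (w (m - 1) (m - 1 - h)))"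
    and "nth_largest_leader q n 1 \<le> n" and "nth_largest_leader q n 2 \<le> n"
proof -
  have odd: "odd (m - 1 + (m - 1 - g))" "odd (m - 1 + (m - 1 - h))"
    using g even_m m_ge_2 by auto
  have less: "w (m - 1) (m - 1 - h) < n"
    by (rule w_less[OF odd(2)]) (use m_ge_2 in auto)
  have w_less_w: "w (m - 1) (m - 1 - g) < w (m - 1) (m - 1 - h)"
    by (rule w_strict[OF odd]) (use g m_ge_2 in auto)
  note first = uncovered_first[OF g(1,2) other_cosets_first[OF w_less_w less other]]
  show "nth_largest_leader q n 2 < \<delta> \<Longrightarrow> \<delta> \<le> nth_largest_leader q n 1 \<Longrightarrow>
      uncovered \<delta> = 1 + card (C (w (m - 1) (m - 1 - g)))"
    by (rule first(1))
  show "nth_largest_leader q n 1 \<le> n" "nth_largest_leader q n 2 \<le> n"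
    by (rule first(2), rule first(3))
  have max: "\<forall>v\<in>C (w (m - 1) (m - 1 - g)). v \<le> w (m - 1) (m - 1 - g)"
    "\<forall>v\<in>C (w (m - 1) (m - 1 - h)). v \<le> w (m - 1) (m - 1 - h)"
    using coset_w_le g by simp_all
  show "uncovered (nth_largest_leader q n 2) =
      1 + card (C (w (m - 1) (m - 1 - g))) + card (C (w (m - 1) (m - 1 - h)))"
    by (rule card_complement_second[OF w_pos[OF odd(1)] w_less_w less max other refl])
qed

text \<open>The counts are 1 for the residue 0, 3 for the coset of half size and 6 for a full
  coset.\<close>

lemma uncovered_6:
  assumes m: "m = 6"
  shows "nth_largest_leader q n 2 < \<delta> \<Longrightarrow> \<delta> \<le> nth_largest_leader q n 1 \<Longrightarrow> uncovered \<delta> = 4"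
    and "uncovered (nth_largest_leader q n 2) = 10"
    and "nth_largest_leader q n 1 \<le> n" and "nth_largest_leader q n 2 \<le> n"
  using uncovered_second[of 3 1] cosets_6[OF m] card_coset_w_6[OF m] card_coset_w[of 1]
  by (simp_all add: m)

lemma uncovered_8:
  assumes m: "m = 8"
  shows "nth_largest_leader q n 2 < \<delta> \<Longrightarrow> \<delta> \<le> nth_largest_leader q n 1 \<Longrightarrow> uncovered \<delta> = 9"
    and "q \<noteq> 3 \<Longrightarrow> uncovered (nth_largest_leader q n 2) = 17"
    and "nth_largest_leader q n 1 \<le> n" and "nth_largest_leader q n 2 \<le> n"
  using uncovered_first[of 3] uncovered_second(2)[of 3 1] cosets_8_first[OF m] cosets_8[OF m]
    card_coset_w[of 3] card_coset_w[of 1] q_ge_3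
  by (simp_all add: m)

lemma uncovered_12:
  assumes m: "m = 12"
  shows "nth_largest_leader q n 2 < \<delta> \<Longrightarrow> \<delta> \<le> nth_largest_leader q n 1 \<Longrightarrow> uncovered \<delta> = 13"
    and "uncovered (nth_largest_leader q n 2) = 25"
    and "nth_largest_leader q n 1 \<le> n" and "nth_largest_leader q n 2 \<le> n"
  using uncovered_second[of 5 3] cosets_12[OF m] card_coset_w[of 5] card_coset_w[of 3]
  by (simp_all add: m)

end

subsection \<open>Words and polynomials\<close>

definition word_poly :: "'a::zero vec \<Rightarrow> 'a poly" where
  "word_poly c = Poly (list_of_vec c)"

lemma coeff_word_poly: "poly.coeff (word_poly c) i = (if i < dim_vec c then c $ i else 0)"
  by (simp add: word_poly_def nth_default_def)

text \<open>The disjunction admits the zero polynomial for \<open>n = 0\<close>, where no degree is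
  below \<open>n\<close>.\<close>

lemma word_poly_vec_coeff:
  assumes "p = 0 \<or> degree p < n"
  shows "word_poly (vec n (poly.coeff p)) = p"
  using assms by (intro poly_eqI) (auto simp: coeff_word_poly coeff_eq_0)

lemma vec_coeff_word_poly: "c \<in> carrier_vec n \<Longrightarrow> vec n (poly.coeff (word_poly c)) = c"
  by (intro eq_vecI) (auto simp: coeff_word_poly)

lemma degree_word_poly: "c \<in> carrier_vec n \<Longrightarrow> word_poly c = 0 \<or> degree (word_poly c) < n"
  using coeff_word_poly[of c "degree (word_poly c)"] by (auto split: if_splits)

lemma word_poly_add:
  "u \<in> carrier_vec n \<Longrightarrow> v \<in> carrier_vec n \<Longrightarrow> word_poly (u + v) = word_poly u + word_poly v"
  for u v :: "'a::comm_ring_1 vec"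
  by (intro poly_eqI) (auto simp: coeff_word_poly)

lemma word_poly_diff:
  "u \<in> carrier_vec n \<Longrightarrow> v \<in> carrier_vec n \<Longrightarrow> word_poly (u - v) = word_poly u - word_poly v"
  for u v :: "'a::comm_ring_1 vec"
  by (intro poly_eqI) (auto simp: coeff_word_poly)

lemma word_poly_smult: "word_poly (a \<cdot>\<^sub>v u) = Polynomial.smult a (word_poly u)"
  for u :: "'a::comm_ring_1 vec"
  by (intro poly_eqI) (auto simp: coeff_word_poly)

lemma poly_map_word_poly:
  fixes \<phi> :: "'a::zero \<Rightarrow> 'b::comm_semiring_1"
  assumes "c \<in> carrier_vec n" "\<phi> 0 = 0"
  shows "poly (map_poly \<phi> (word_poly c)) x = (\<Sum>i<n. \<phi> (c $ i) * x ^ i)"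
proof (cases "n = 0")
  case True
  then have "word_poly c = 0"
    using degree_word_poly[OF assms(1)] by simp
  then show ?thesis using True by simp
next
  case False
  have "degree (map_poly \<phi> (word_poly c)) < n"
    using degree_map_poly_le[of \<phi> "word_poly c"] degree_word_poly[OF assms(1)] False by auto
  then have "poly (map_poly \<phi> (word_poly c)) x = (\<Sum>i<n. poly.coeff (map_poly \<phi> (word_poly c)) i * x ^ i)"
    unfolding poly_altdef by (intro sum.mono_neutral_left) (auto simp: coeff_eq_0)
  then show ?thesis
    using assms by (simp add: coeff_map_poly coeff_word_poly)
qed

subsection \<open>The dimension of a polynomial code\<close>

text \<open>Multiplication by \<open>g\<close> maps the words of length \<open>n - degree g\<close>
  linearly and injectively onto the multiples of \<open>g\<close>; rank-nullity gives the
  dimension.\<close>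

lemma
  fixes g :: "'a::field poly"
  assumes g: "g \<noteq> 0" "degree g \<le> n"
  defines "C \<equiv> {c \<in> carrier_vec n. g dvd word_poly c}"
  shows linear_code_multiples: "linear_code n C"
    and code_dim_multiples: "code_dim n C = n - degree g"
proof -
  define k where "k = n - degree g"
  define T where "T u = vec n (poly.coeff (g * word_poly u))" for u
  have degree_mult: "g * word_poly u = 0 \<or> degree (g * word_poly u) < n" if "u \<in> carrier_vec k" for u
    using degree_word_poly[OF that] g by (cases "word_poly u = 0") (auto simp: degree_mult_eq k_def)
  have word_poly_T: "word_poly (T u) = g * word_poly u" if "u \<in> carrier_vec k" for u
    unfolding T_def by (rule word_poly_vec_coeff[OF degree_mult[OF that]])
  let ?V = "module_vec TYPE('a) k" and ?W = "module_vec TYPE('a) n"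
  interpret V: vec_space "TYPE('a)" k .
  interpret W: vec_space "TYPE('a)" n .
  interpret T: linear_map class_ring ?V ?W T
  proof (unfold_locales)
    show "T \<in> LinearCombinations.module_hom class_ring ?V ?W"
      unfolding LinearCombinations.module_hom_def module_vec_simps
      by (auto simp: T_def word_poly_add word_poly_smult distrib_left intro!: eq_vecI)
  qed
  have im: "T.imT = C"
    unfolding T.im_def module_vec_simps
  proof (intro Set.set_eqI iffI)
    fix c assume "c \<in> T ` carrier_vec k"
    then show "c \<in> C"
      using word_poly_T by (auto simp: C_def T_def)
  next
    fix c assume "c \<in> C"
    then obtain p where c: "c \<in> carrier_vec n" and p: "word_poly c = g * p"
      unfolding C_def dvd_def by blast
    have "p = 0 \<or> degree p < k"
      using degree_word_poly[OF c] g unfolding p by (cases "p = 0") (auto simp: degree_mult_eq k_def)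
    then have "word_poly (vec k (poly.coeff p)) = p"
      by (rule word_poly_vec_coeff)
    then have "T (vec k (poly.coeff p)) = c"
      using vec_coeff_word_poly[OF c] p by (simp add: T_def)
    then show "c \<in> T ` carrier_vec k"
      by (metis image_eqI vec_carrier)
  qed
  have "inj_on T (carrier ?V)"
    unfolding module_vec_simps
  proof (rule inj_onI)
    fix u v assume uv: "u \<in> carrier_vec k" "v \<in> carrier_vec k" "T u = T v"
    then have "g * word_poly u = g * word_poly v"
      by (metis word_poly_T)
    then have "word_poly u = word_poly v"
      using g by simp
    then show "u = v"
      by (metis uv(1,2) vec_coeff_word_poly)
  qed
  then have "vectorspace.dim class_ring (W.vs T.imT) = V.dim"
    using T.rank_nullity[OF V.fin_dim] T.inj_imp_dim_ker0 by simp
  then show "code_dim n C = n - degree g"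
    unfolding code_dim_def im V.dim_is_n by (simp add: k_def)
  show "linear_code n C"
    unfolding linear_code_def using T.imT_is_subspace im by simp
qed

subsection \<open>The BCH bound\<close>

text \<open>A word with few nonzero positions is tested against the polynomial that vanishes at all
  but one of the corresponding locators.\<close>

lemma bch_bound:
  fixes \<beta> :: "'b::field"
  assumes inj: "inj_on (\<lambda>i. \<beta> ^ i) {..<n}" and nz: "\<beta> \<noteq> 0"
    and zero: "\<And>j. 1 \<le> j \<Longrightarrow> j < \<delta> \<Longrightarrow> (\<Sum>i<n. c i * (\<beta> ^ j) ^ i) = 0"
    and ex: "k < n" "c k \<noteq> 0"
  shows "\<delta> \<le> card {i. i < n \<and> c i \<noteq> 0}"
proof (rule ccontr)
  define S where "S = {i. i < n \<and> c i \<noteq> 0}"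
  assume "\<not> ?thesis"
  then have small: "card S < \<delta>" by (simp add: S_def)
  have S: "finite S" "k \<in> S" "S \<subseteq> {..<n}"
    using ex by (auto simp: S_def)
  define P where "P = (\<Prod>i\<in>S - {k}. [:- (\<beta> ^ i), 1:])"
  have "degree P \<le> (\<Sum>i\<in>S - {k}. degree [:- (\<beta> ^ i), 1:])"
    using degree_prod_sum_le[of "S - {k}" "\<lambda>i. [:- (\<beta> ^ i), 1:]"] S(1) by (simp add: P_def)
  then have deg: "degree P + 1 < \<delta>"
    using small S card_gt_0_iff[of S] by auto
  \<comment> \<open>The extra factor \<open>\<beta> ^ i\<close> shifts the exponents
    \<open>0, ..., degree P\<close> to \<open>1, ..., degree P + 1\<close>, all within the range of
    known zeros.\<close>
  have "(\<Sum>i<n. c i * \<beta> ^ i * poly P (\<beta> ^ i)) =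
      (\<Sum>i<n. \<Sum>l\<le>degree P. poly.coeff P l * (c i * (\<beta> ^ Suc l) ^ i))"
    unfolding poly_altdef sum_distrib_left
    by (intro sum.cong refl) (simp add: power_mult_distrib mult_ac flip: power_mult)
  also have "\<dots> = (\<Sum>l\<le>degree P. poly.coeff P l * (\<Sum>i<n. c i * (\<beta> ^ Suc l) ^ i))"
    unfolding sum_distrib_left by (rule sum.swap)
  also have "\<dots> = 0"
  proof (intro sum.neutral ballI)
    fix l assume "l \<in> {..degree P}"
    then have "(\<Sum>i<n. c i * (\<beta> ^ Suc l) ^ i) = 0"
      using deg by (intro zero) auto
    then show "poly.coeff P l * (\<Sum>i<n. c i * (\<beta> ^ Suc l) ^ i) = 0"
      by (simp only: mult_zero_right)
  qed
  finally have "(\<Sum>i<n. c i * \<beta> ^ i * poly P (\<beta> ^ i)) = 0" .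
  moreover have "(\<Sum>i<n. c i * \<beta> ^ i * poly P (\<beta> ^ i)) = (\<Sum>i\<in>{k}. c i * \<beta> ^ i * poly P (\<beta> ^ i))"
  proof (rule sum.mono_neutral_right)
    show "\<forall>i\<in>{..<n} - {k}. c i * \<beta> ^ i * poly P (\<beta> ^ i) = 0"
      using S(1) by (auto simp: P_def poly_prod S_def)
  qed (use ex in auto)
  moreover have "poly P (\<beta> ^ k) \<noteq> 0"
    using S inj by (auto simp: P_def poly_prod inj_on_def)
  ultimately show False
    using ex nz by simp
qed

text \<open>Two distinct words make the set of distances nonempty, so its infimum is attained;
  closure under differences turns that distance into a weight.\<close>

lemma min_dist_ge:
  fixes D :: "'a::comm_ring_1 vec set"
  assumes D: "D \<subseteq> carrier_vec n" and diff: "\<And>u v. u \<in> D \<Longrightarrow> v \<in> D \<Longrightarrow> u - v \<in> D"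
    and two: "x \<in> D" "y \<in> D" "x \<noteq> y"
    and weight: "\<And>c. c \<in> D \<Longrightarrow> c \<noteq> 0\<^sub>v n \<Longrightarrow> d \<le> card {i. i < n \<and> c $ i \<noteq> 0}"
  shows "d \<le> min_dist D"
proof -
  let ?X = "{hamming_dist u v | u v. u \<in> D \<and> v \<in> D \<and> u \<noteq> v}"
  have "Inf ?X \<in> ?X"
    using two by (intro Inf_nat_def1) blast
  then obtain u v where uv: "Inf ?X = hamming_dist u v" "u \<in> D" "v \<in> D" "u \<noteq> v"
    by auto
  have carrier: "u \<in> carrier_vec n" "v \<in> carrier_vec n"
    using uv D by auto
  have "u - v \<noteq> 0\<^sub>v n"
    using carrier uv(4) by (auto simp: vec_eq_iff)
  then have "d \<le> card {i. i < n \<and> (u - v) $ i \<noteq> 0}"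
    by (rule weight[OF diff[OF uv(2,3)]])
  also have "{i. i < n \<and> (u - v) $ i \<noteq> 0} = {i. i < dim_vec u \<and> u $ i \<noteq> v $ i}"
    using carrier by auto
  finally show ?thesis
    using uv(1) by (simp add: min_dist_def hamming_dist_def)
qed

subsection \<open>Descent to the subfield\<close>

text \<open>Multiplication by a nonzero \<open>x\<close> permutes the nonzero elements; compare
  their product before and after.\<close>

lemma finite_field_power_card:
  fixes x :: "'a::{field,finite}"
  shows "x ^ CARD('a) = x"
proof (cases "x = 0")
  case False
  let ?U = "UNIV - {0} :: 'a set"
  have "bij_betw ((*) x) ?U ?U"
    by (rule bij_betw_byWitness[where f' = "\<lambda>y. y / x"]) (use False in auto)
  then have "(\<Prod>y\<in>?U. x * y) = \<Prod>?U"
    by (rule prod.reindex_bij_betw)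
  then have "x ^ card ?U * \<Prod>?U = 1 * \<Prod>?U"
    by (simp add: prod.distrib)
  then have "x ^ card ?U = 1"
    unfolding mult_cancel_right by simp
  moreover have "CARD('a) = Suc (card ?U)"
    by (simp add: card_Suc_Diff1)
  ultimately show ?thesis
    by (simp only: power_Suc mult_1_right)
qed simp

lemma prod_linear_dvd:
  fixes f :: "'i \<Rightarrow> 'b::field"
  assumes "finite U" "inj_on f U" "\<And>i. i \<in> U \<Longrightarrow> poly F (f i) = 0"
  shows "(\<Prod>i\<in>U. [:- f i, 1:]) dvd F"
  using assms
proof (induction U arbitrary: F)
  case (insert i U)
  obtain H where H: "F = (\<Prod>i\<in>U. [:- f i, 1:]) * H"
    using insert by (auto simp: dvd_def)
  have "poly (\<Prod>i\<in>U. [:- f i, 1:]) (f i) \<noteq> 0"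
    using insert.hyps insert.prems(1) by (auto simp: poly_prod inj_on_def)
  then have "poly H (f i) = 0"
    using insert.prems(2)[of i] by (simp add: H)
  then have "[:- f i, 1:] * (\<Prod>i\<in>U. [:- f i, 1:]) dvd H * (\<Prod>i\<in>U. [:- f i, 1:])"
    unfolding poly_eq_0_iff_dvd by (rule mult_dvd_mono) simp
  then show ?case
    unfolding H prod.insert[OF insert.hyps] by (simp only: mult.commute)
qed simp

locale finite_field_extension = field_hom \<phi>
  for \<phi> :: "'a::{field_gcd,finite} \<Rightarrow> 'b::{field,finite}" +
  fixes q k :: nat
  assumes card_a: "CARD('a) = q" and q_power: "q = CHAR('b) ^ k"
begin

lemma prime_char: "prime CHAR('b)"
  using prime_CHAR_semidom[where ?'a = 'b] finite_imp_CHAR_pos[where ?'a = 'b] by simp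

lemma q_gt_1: "q > 1"
proof -
  have "card {0, 1 :: 'a} \<le> CARD('a)"
    by (intro card_mono) auto
  then show ?thesis
    by (simp add: card_a)
qed

text \<open>The image of the small field already supplies \<open>q\<close> roots of a polynomial of
  degree \<open>q\<close>.\<close>

lemma frobenius_range: "x ^ q = x \<longleftrightarrow> x \<in> range \<phi>"
proof -
  let ?P = "Polynomial.monom 1 q - [:0, 1:] :: 'b poly" and ?R = "{x :: 'b. x ^ q = x}"
  have deg: "degree ?P = q"
    unfolding diff_conv_add_uminus
    by (subst degree_add_eq_left) (use q_gt_1 in \<open>auto simp: degree_monom_eq\<close>)
  have "range \<phi> \<subseteq> ?R"
    using finite_field_power_card[where ?'a = 'a] by (auto simp: card_a simp flip: hom_power)
  moreover have "card ?R \<le> card (range \<phi>)"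
  proof -
    have "?R = {x. poly ?P x = 0}"
      by (auto simp: poly_monom)
    also have "card \<dots> \<le> degree ?P"
      using deg q_gt_1 by (intro card_poly_roots_bound) auto
    also have "\<dots> = card (range \<phi>)"
      using deg card_a by (simp add: card_image inj_f)
    finally show ?thesis .
  qed
  ultimately have "range \<phi> = ?R"
    by (intro card_seteq) auto
  then show ?thesis by auto
qed

sublocale frobenius: comm_ring_hom "\<lambda>x :: 'b. x ^ q"
  by unfold_locales
    (use q_gt_1 in \<open>auto simp: power_mult_distrib freshmans_dream'[OF prime_char q_power]\<close>)

sublocale frobenius_poly: map_poly_comm_ring_hom "\<lambda>x :: 'b. x ^ q" ..

sublocale phi_poly: map_poly_inj_idom_hom \<phi> ..

lemma poly_map_frobenius: "poly (map_poly \<phi> p) (x ^ q) = poly (map_poly \<phi> p) x ^ q"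
proof -
  have "map_poly (\<lambda>x. x ^ q) (map_poly \<phi> p) = map_poly \<phi> p"
    using frobenius_range by (intro poly_eqI) (simp add: coeff_map_poly)
  then show ?thesis
    by (metis frobenius.poly_map_poly)
qed

lemma descend_poly:
  assumes "map_poly (\<lambda>x. x ^ q) P = P"
  obtains p where "map_poly \<phi> p = P"
proof
  have "poly.coeff P i \<in> range \<phi>" for i
    using arg_cong[OF assms, of "\<lambda>p. poly.coeff p i"] by (simp flip: frobenius_range)
  then show "map_poly \<phi> (map_poly (inv_into UNIV \<phi>) P) = P"
    \<comment> \<open>The inverse must send 0 to 0 for \<open>map_poly\<close> to act
      coefficientwise.\<close>
    using inv_into_f_f[OF inj_f UNIV_I, of 0]
    by (intro poly_eqI) (simp add: coeff_map_poly f_inv_into_f)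
qed

text \<open>The definite description requires existence and uniqueness first: \<open>p\<close>
  witnesses that \<open>x\<close> is algebraic, and two monic candidates divide each other by
  division with remainder.\<close>

lemma minimal_poly_dvd_iff:
  assumes "p \<noteq> 0" "poly (map_poly \<phi> p) x = 0"
  shows "minimal_poly \<phi> x dvd r \<longleftrightarrow> poly (map_poly \<phi> r) x = 0"
proof -
  let ?root = "\<lambda>r. poly (map_poly \<phi> r) x = 0"
  define Q where "Q p \<longleftrightarrow> lead_coeff p = 1 \<and> ?root p \<and> (\<forall>r. r \<noteq> 0 \<and> ?root r \<longrightarrow> degree p \<le> degree r)" for p
  obtain p0 where p0: "p0 \<noteq> 0" "?root p0" "\<And>r. r \<noteq> 0 \<Longrightarrow> ?root r \<Longrightarrow> degree p0 \<le> degree r"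
    using ex_has_least_nat[of "\<lambda>p. p \<noteq> 0 \<and> ?root p" p degree] assms by auto
  have Q_dvd: "p dvd r \<longleftrightarrow> ?root r" if Q: "Q p" for p r
  proof
    assume "p dvd r"
    then show "?root r"
      using Q by (auto simp: Q_def hom_distribs)
  next
    assume "?root r"
    moreover have "map_poly \<phi> r = map_poly \<phi> (r div p) * map_poly \<phi> p + map_poly \<phi> (r mod p)"
      unfolding phi_poly.hom_mult[symmetric] phi_poly.hom_add[symmetric] by simp
    ultimately have "?root (r mod p)"
      using Q by (simp add: Q_def)
    then have "r mod p = 0"
      using Q degree_mod_less[of p r] unfolding Q_def by fastforce
    then show "p dvd r" by (simp add: dvd_eq_mod_eq_0)
  qed
  have "Q (Polynomial.smult (inverse (lead_coeff p0)) p0)"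
    using p0 by (auto simp: Q_def hom_distribs)
  moreover have "p = p'" if "Q p" "Q p'" for p p'
    using that Q_dvd[OF that(1), of p'] Q_dvd[OF that(2), of p] poly_dvd_antisym[of p p'] by (simp add: Q_def)
  ultimately have "Q (THE p. Q p)"
    by (metis theI)
  then have "Q (minimal_poly \<phi> x)"
    unfolding minimal_poly_def Q_def .
  then show ?thesis
    by (rule Q_dvd)
qed

end

section \<open>BCH codes for a primitive \<open>n\<close>-th root of unity\<close>

locale bch = finite_field_extension +
  fixes \<beta> :: 'b and n :: nat
  assumes n_gt_0: "n > 0" and root: "\<beta> ^ n = 1" and inj_root: "inj_on (\<lambda>i. \<beta> ^ i) {..<n}"
begin

lemma root_nz: "\<beta> \<noteq> 0"
  using root n_gt_0 by (auto simp: power_0_left)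

lemma power_root_mod: "\<beta> ^ (i mod n) = \<beta> ^ i"
proof -
  have "\<beta> ^ i = (\<beta> ^ n) ^ (i div n) * \<beta> ^ (i mod n)"
    by (simp flip: power_mult power_add)
  then show ?thesis
    by (simp add: root)
qed

abbreviation xn1 :: "'a poly" where "xn1 \<equiv> Polynomial.monom 1 n - 1"

lemma degree_xn1: "degree xn1 = n"
  unfolding diff_conv_add_uminus
  by (subst degree_add_eq_left) (use n_gt_0 in \<open>auto simp: degree_monom_eq\<close>)

lemma xn1_nz: "xn1 \<noteq> 0"
  using degree_xn1 n_gt_0 by auto

lemma xn1_root: "poly (map_poly \<phi> xn1) (\<beta> ^ j) = 0"
proof -
  have "(\<beta> ^ j) ^ n = 1"
    by (metis power_commutes power_mult power_one root mult.commute)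
  then show ?thesis
    by (simp add: hom_distribs poly_monom)
qed

lemmas minimal_poly_root_dvd_iff = minimal_poly_dvd_iff[OF xn1_nz xn1_root]

text \<open>The generator divides \<open>x^n - 1\<close>, so being congruent to one of its multiples
  means being divisible by it, hence by every minimal polynomial.\<close>

lemma mem_bch_code_iff:
  "c \<in> bch_code \<phi> \<beta> n \<delta> \<longleftrightarrow>
     c \<in> carrier_vec n \<and> (\<forall>j\<in>{1..\<delta> - 1}. poly (map_poly \<phi> (word_poly c)) (\<beta> ^ j) = 0)"
proof -
  define g where "g = Lcm ((\<lambda>j. minimal_poly \<phi> (\<beta> ^ j)) ` {1..\<delta> - 1})"
  have g_dvd: "g dvd r \<longleftrightarrow> (\<forall>j\<in>{1..\<delta> - 1}. poly (map_poly \<phi> r) (\<beta> ^ j) = 0)" for r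
    by (simp add: g_def Lcm_dvd_iff minimal_poly_root_dvd_iff)
  have "g dvd xn1"
    unfolding g_dvd using xn1_root by blast
  then have "(\<exists>u. [r = g * u] (mod xn1)) \<longleftrightarrow> g dvd r" for r
    by (metis cong_dvd_iff cong_dvd_modulus cong_refl dvd_def dvd_triv_left)
  then show ?thesis
    unfolding bch_code_def cyclic_code_def word_poly_def[symmetric] g_def[symmetric]
    using g_dvd[of "word_poly c"] by blast
qed

text \<open>The least common multiple is replaced by a product of linear factors, whose degree is
  visible. Multiplication by \<open>q\<close> permutes \<open>U\<close>, so Frobenius fixes the
  product and it descends to the small field.\<close>

lemma bch_code_generator:
  assumes U: "U = (\<Union>j\<in>{1..\<delta> - 1}. cyclotomic_coset q n j)"
  obtains g where "degree g = card U" "g \<noteq> 0"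
    "bch_code \<phi> \<beta> n \<delta> = {c \<in> carrier_vec n. g dvd word_poly c}"
proof -
  define G where "G = (\<Prod>i\<in>U. [:- (\<beta> ^ i), 1:])"
  have U_less: "U \<subseteq> {..<n}"
    using n_gt_0 by (auto simp: U cyclotomic_coset_def)
  then have fin: "finite U"
    by (rule finite_subset) simp
  have inj: "inj_on (\<lambda>i. \<beta> ^ i) U"
    using inj_root U_less by (rule inj_on_subset)
  have closed: "i * q mod n \<in> U" if iU: "i \<in> U" for i
  proof -
    obtain j l where "j \<in> {1..\<delta> - 1}" "i = j * q ^ l mod n"
      using iU unfolding U cyclotomic_coset_def by blast
    then have "i * q mod n = j * q ^ Suc l mod n"
      by (simp add: mod_mult_right_eq mult_ac)
    then show ?thesis
      using \<open>j \<in> _\<close> unfolding U cyclotomic_coset_def by blast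
  qed
  have frob: "(\<beta> ^ i) ^ q = \<beta> ^ (i * q mod n)" for i
    by (simp add: power_root_mod power_mult)
  have inj_frob: "x = y" if "x ^ q = y ^ q" for x y :: 'b
    using frobenius.hom_minus[of x y] that by simp
  have "inj_on (\<lambda>i. i * q mod n) U"
  proof (rule inj_onI)
    fix i j assume ij: "i \<in> U" "j \<in> U" "i * q mod n = j * q mod n"
    then have "(\<beta> ^ i) ^ q = (\<beta> ^ j) ^ q"
      by (simp add: frob)
    then show "i = j"
      using inj_frob inj_onD[OF inj _ ij(1,2)] by blast
  qed
  then have bij: "bij_betw (\<lambda>i. i * q mod n) U U"
    using fin closed by (intro bij_betw_imageI endo_inj_surj) auto
  have "map_poly (\<lambda>x. x ^ q) G = (\<Prod>i\<in>U. [:- (\<beta> ^ (i * q mod n)), 1:])"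
    unfolding G_def frobenius_poly.hom_prod
    by (intro prod.cong refl) (simp add: frob frobenius.hom_uminus)
  also have "\<dots> = G"
    unfolding G_def by (rule prod.reindex_bij_betw[OF bij])
  finally obtain g where g: "map_poly \<phi> g = G"
    by (rule descend_poly)
  have "degree g = degree G"
    by (simp flip: g)
  also have "\<dots> = card U"
    unfolding G_def by (subst degree_prod_eq_sum_degree) auto
  finally have deg: "degree g = card U" .
  have "G \<noteq> 0"
    using fin by (simp add: G_def)
  then have nz: "g \<noteq> 0"
    using g by auto
  have "g dvd r \<longleftrightarrow> (\<forall>j\<in>{1..\<delta> - 1}. poly (map_poly \<phi> r) (\<beta> ^ j) = 0)" for r
  proof
    assume "g dvd r"
    then have "G dvd map_poly \<phi> r"
      using g by (metis dvd_def phi_poly.hom_mult)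
    then have root: "poly (map_poly \<phi> r) (\<beta> ^ i) = 0" if "i \<in> U" for i
      using that fin by (auto simp: G_def poly_prod dvd_def)
    have "poly (map_poly \<phi> r) (\<beta> ^ j) = 0" if "j \<in> {1..\<delta> - 1}" for j
    proof -
      have "j * q ^ 0 mod n \<in> U"
        using that unfolding U cyclotomic_coset_def by blast
      then show ?thesis
        using root[of "j mod n"] by (simp add: power_root_mod)
    qed
    then show "\<forall>j\<in>{1..\<delta> - 1}. poly (map_poly \<phi> r) (\<beta> ^ j) = 0" by blast
  next
    assume roots: "\<forall>j\<in>{1..\<delta> - 1}. poly (map_poly \<phi> r) (\<beta> ^ j) = 0"
    \<comment> \<open>As \<open>r\<close> has coefficients in the small field, Frobenius spreads
      each zero over its whole coset.\<close>
    have "poly (map_poly \<phi> r) (\<beta> ^ (j * q ^ l)) = 0" if "j \<in> {1..\<delta> - 1}" for j l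
    proof (induction l)
      case 0
      then show ?case using roots that by simp
    next
      case (Suc l)
      have "\<beta> ^ (j * q ^ Suc l) = (\<beta> ^ (j * q ^ l)) ^ q"
        by (simp add: mult_ac flip: power_mult)
      then show ?case
        using Suc q_gt_1 by (simp add: poly_map_frobenius)
    qed
    then have "poly (map_poly \<phi> r) (\<beta> ^ i) = 0" if "i \<in> U" for i
      using that by (auto simp: U cyclotomic_coset_def power_root_mod)
    then have "G dvd map_poly \<phi> r"
      unfolding G_def using fin inj by (intro prod_linear_dvd)
    then show "g dvd r"
      using g dvd_map_poly_hom_imp_dvd by simp
  qed
  then show ?thesis
    using that[OF deg nz] mem_bch_code_iff by blast
qed

lemma
  assumes "\<delta> \<le> n"
  shows linear_bch_code: "linear_code n (bch_code \<phi> \<beta> n \<delta>)"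
    and code_dim_bch_code: "code_dim n (bch_code \<phi> \<beta> n \<delta>) =
      card ({..<n} - (\<Union>j\<in>{1..\<delta> - 1}. cyclotomic_coset q n j))"
proof -
  define U where "U = (\<Union>j\<in>{1..\<delta> - 1}. cyclotomic_coset q n j)"
  have U: "U \<subseteq> {..<n}"
    using n_gt_0 by (auto simp: U_def cyclotomic_coset_def)
  obtain g where g: "degree g = card U" "g \<noteq> 0"
    "bch_code \<phi> \<beta> n \<delta> = {c \<in> carrier_vec n. g dvd word_poly c}"
    using bch_code_generator[OF U_def] .
  have "card U \<le> n"
    using card_mono[OF _ U] by simp
  moreover have "card ({..<n} - U) = n - card U"
    using card_Diff_subset[OF finite_subset[OF U] U] by simp
  ultimately show "linear_code n (bch_code \<phi> \<beta> n \<delta>)"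
    "code_dim n (bch_code \<phi> \<beta> n \<delta>) = card ({..<n} - (\<Union>j\<in>{1..\<delta> - 1}. cyclotomic_coset q n j))"
    using linear_code_multiples[of g n] code_dim_multiples[of g n] g by (simp_all add: U_def)
qed

lemma min_dist_bch_code:
  assumes "\<delta> \<le> n"
  shows "\<delta> \<le> min_dist (bch_code \<phi> \<beta> n \<delta>)"
proof (rule min_dist_ge)
  let ?C = "bch_code \<phi> \<beta> n \<delta>"
  show carrier: "?C \<subseteq> carrier_vec n"
    using mem_bch_code_iff by blast
  show "u - v \<in> ?C" if "u \<in> ?C" "v \<in> ?C" for u v
    using that by (auto simp: mem_bch_code_iff word_poly_diff[of _ n] hom_distribs)
  show "0\<^sub>v n \<in> ?C"
    by (auto simp: mem_bch_code_iff poly_map_word_poly[of _ n])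
  \<comment> \<open>The all-one word serves as a nonzero codeword: for \<open>0 < j < n\<close> it
    evaluates to a full geometric sum over \<open>\<beta> ^ j \<noteq> 1\<close>, which
    vanishes.\<close>
  show "vec n (\<lambda>_. 1) \<in> ?C"
  proof -
    have "(\<Sum>i<n. (\<beta> ^ j) ^ i) = 0" if j: "1 \<le> j" "j \<le> \<delta> - 1" for j
    proof -
      have "j \<in> {..<n}" "0 \<in> {..<n}" "j \<noteq> 0"
        using j assms n_gt_0 by auto
      then have "\<beta> ^ j \<noteq> 1"
        using inj_onD[OF inj_root, of j 0] by auto
      moreover have "(\<beta> ^ j) ^ n = 1"
        by (metis power_mult power_one root mult.commute)
      ultimately show ?thesis
        by (simp add: sum_gp_strict)
    qed
    then show ?thesis
      by (auto simp: mem_bch_code_iff poly_map_word_poly[of _ n])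
  qed
  show "0\<^sub>v n \<noteq> vec n (\<lambda>_. 1 :: 'a)"
    using n_gt_0 by (auto simp: vec_eq_iff)
  fix c assume c: "c \<in> ?C" "c \<noteq> 0\<^sub>v n"
  then have c_carrier: "c \<in> carrier_vec n"
    using carrier by blast
  obtain k where k: "k < n" "c $ k \<noteq> 0"
    using c(2) c_carrier by (auto simp: vec_eq_iff)
  have "\<delta> \<le> card {i. i < n \<and> \<phi> (c $ i) \<noteq> 0}"
  proof (rule bch_bound[OF inj_root root_nz])
    show "(\<Sum>i<n. \<phi> (c $ i) * (\<beta> ^ j) ^ i) = 0" if "1 \<le> j" "j < \<delta>" for j
      using c(1) that by (auto simp: mem_bch_code_iff poly_map_word_poly[of _ n])
  qed (use k in auto)
  then show "\<delta> \<le> card {i. i < n \<and> c $ i \<noteq> 0}"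
    by simp
qed

end

subsection \<open>The codes for \<open>s = 3, 4, 6\<close>\<close>

theorem theorem19:
  fixes \<phi> :: "'a::{field_gcd,finite} \<Rightarrow> 'b::{field,finite}"
    and \<alpha> \<beta>\<^sub>1 :: 'b
    and q s n \<delta>\<^sub>1 \<delta>\<^sub>2 :: nat
  assumes "primepow q" and "odd q" and "s > 0"
    and "n = (q ^ (2 * s) - 1) div (q + 1)"
    and "CARD('a) = q" and "CARD('b) = q ^ (2 * s)" and "field_hom \<phi>"
    and "range (\<lambda>k::nat. \<alpha> ^ k) = UNIV - {0}"
    and "\<beta>\<^sub>1 = \<alpha> ^ (q + 1)"
    and "\<delta>\<^sub>1 = nth_largest_leader q n 1"
    and "\<delta>\<^sub>2 = nth_largest_leader q n 2"
  shows
    "(s = 3 \<longrightarrow>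
       (\<forall>\<delta>. \<delta>\<^sub>2 + 1 \<le> \<delta> \<and> \<delta> \<le> \<delta>\<^sub>1 \<longrightarrow>
          linear_code ((q ^ 6 - 1) div (q + 1)) (bch_code \<phi> \<beta>\<^sub>1 n \<delta>) \<and>
          code_dim n (bch_code \<phi> \<beta>\<^sub>1 n \<delta>) = 4 \<and>
          \<delta> \<le> min_dist (bch_code \<phi> \<beta>\<^sub>1 n \<delta>)) \<and>
       code_dim n (bch_code \<phi> \<beta>\<^sub>1 n \<delta>\<^sub>2) = 10 \<and>
       \<delta>\<^sub>2 \<le> min_dist (bch_code \<phi> \<beta>\<^sub>1 n \<delta>\<^sub>2)) \<and>
     (s = 4 \<longrightarrow>
       (\<forall>\<delta>. \<delta>\<^sub>2 + 1 \<le> \<delta> \<and> \<delta> \<le> \<delta>\<^sub>1 \<longrightarrow>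
          linear_code ((q ^ 8 - 1) div (q + 1)) (bch_code \<phi> \<beta>\<^sub>1 n \<delta>) \<and>
          code_dim n (bch_code \<phi> \<beta>\<^sub>1 n \<delta>) = 9 \<and>
          \<delta> \<le> min_dist (bch_code \<phi> \<beta>\<^sub>1 n \<delta>)) \<and>
       (q \<noteq> 3 \<longrightarrow> code_dim n (bch_code \<phi> \<beta>\<^sub>1 n \<delta>\<^sub>2) = 17) \<and>
       \<delta>\<^sub>2 \<le> min_dist (bch_code \<phi> \<beta>\<^sub>1 n \<delta>\<^sub>2)) \<and>
     (s = 6 \<longrightarrow>
       (\<forall>\<delta>. \<delta>\<^sub>2 + 1 \<le> \<delta> \<and> \<delta> \<le> \<delta>\<^sub>1 \<longrightarrow>
          linear_code ((q ^ 12 - 1) div (q + 1)) (bch_code \<phi> \<beta>\<^sub>1 n \<delta>) \<and>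
          code_dim n (bch_code \<phi> \<beta>\<^sub>1 n \<delta>) = 13 \<and>
          \<delta> \<le> min_dist (bch_code \<phi> \<beta>\<^sub>1 n \<delta>)) \<and>
       code_dim n (bch_code \<phi> \<beta>\<^sub>1 n \<delta>\<^sub>2) = 25 \<and>
       \<delta>\<^sub>2 \<le> min_dist (bch_code \<phi> \<beta>\<^sub>1 n \<delta>\<^sub>2))"
proof -
  obtain p k where p: "prime p" "k > 0" "q = p ^ k"
    using \<open>primepow q\<close> by (auto simp: primepow_def)
  have q_ge_3: "q \<ge> 3"
    using primepow_gt_Suc_0[OF \<open>primepow q\<close>] \<open>odd q\<close> by (cases "q = 2") auto
  \<comment> \<open>The characteristic is a prime dividing a power of \<open>p\<close>, hence
    \<open>p\<close>; this makes \<open>x ^ q\<close> a ring homomorphism.\<close>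
  have "CHAR('b) dvd p ^ (k * (2 * s))"
    using CHAR_dvd_CARD[where ?'a = 'b] assms(6) p(3) by (simp add: power_mult)
  moreover have "prime CHAR('b)"
    using prime_CHAR_semidom[where ?'a = 'b] finite_imp_CHAR_pos[where ?'a = 'b] by simp
  ultimately have char: "CHAR('b) = p"
    using p(1) by (metis prime_dvd_power primes_dvd_imp_eq)
  interpret field_hom \<phi> by fact
  interpret finite_field_extension \<phi> q k
    by unfold_locales (use assms(5) p(3) char in auto)
  have "q + 1 dvd q ^ (2 * s) - 1"
  proof -
    have "[int q = - 1] (mod int (q + 1))"
      by (simp add: cong_iff_dvd_diff add.commute)
    then have "[int q ^ (2 * s) = (- 1) ^ (2 * s)] (mod int (q + 1))"
      by (rule cong_pow)
    then have "int (q + 1) dvd int (q ^ (2 * s) - 1)"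
      using q_ge_3 by (simp add: cong_iff_dvd_diff of_nat_diff)
    then show ?thesis
      by (simp only: int_dvd_int_iff)
  qed
  then have n_mult: "n * (q + 1) = q ^ (2 * s) - 1"
    unfolding assms(4) by (rule dvd_div_mult_self)
  interpret bch_length q "2 * s" n
    by unfold_locales (use q_ge_3 n_mult \<open>s > 0\<close> in auto)
  have card_b: "CARD('b) = Suc K"
    using assms(6) q_pow_m_eq by simp
  have \<alpha>: "\<alpha> \<noteq> 0"
    using assms(8) rangeI[of "\<lambda>k. \<alpha> ^ k" 1] by auto
  have "\<alpha> * \<alpha> ^ K = \<alpha> * 1"
    using finite_field_power_card[of \<alpha>] unfolding card_b by simp
  then have \<alpha>_K: "\<alpha> ^ K = 1"
    using \<alpha> by simp
  \<comment> \<open>The first \<open>K\<close> powers exhaust the \<open>K\<close> nonzero elements,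
    so they are distinct.\<close>
  have inj_\<alpha>: "inj_on (\<lambda>k. \<alpha> ^ k) {..<K}"
  proof (rule eq_card_imp_inj_on)
    have "\<alpha> ^ k = \<alpha> ^ (k mod K)" for k
    proof -
      have "\<alpha> ^ k = (\<alpha> ^ K) ^ (k div K) * \<alpha> ^ (k mod K)"
        by (simp flip: power_mult power_add)
      then show ?thesis by (simp add: \<alpha>_K)
    qed
    then have "range (\<lambda>k. \<alpha> ^ k) \<subseteq> (\<lambda>k. \<alpha> ^ k) ` {..<K}"
      using K_pos by (metis image_eqI image_subsetI lessThan_iff mod_less_divisor)
    then have "(\<lambda>k. \<alpha> ^ k) ` {..<K} = range (\<lambda>k. \<alpha> ^ k)"
      by (rule subset_antisym[OF image_mono[OF subset_UNIV]])
    then show "card ((\<lambda>k. \<alpha> ^ k) ` {..<K}) = card {..<K}"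
      unfolding assms(8) by (simp add: card_Diff_singleton card_b)
  qed simp
  interpret code: bch \<phi> q k \<beta>\<^sub>1 n
  proof
    show "n > 0"
      using n_gt_1 by simp
    show "\<beta>\<^sub>1 ^ n = 1"
      unfolding assms(9) power_mult[symmetric] mult_n by (rule \<alpha>_K)
    show "inj_on (\<lambda>i. \<beta>\<^sub>1 ^ i) {..<n}"
    proof (rule inj_onI)
      fix i j assume ij: "i \<in> {..<n}" "j \<in> {..<n}" "\<beta>\<^sub>1 ^ i = \<beta>\<^sub>1 ^ j"
      have "(q + 1) * i \<in> {..<K}" "(q + 1) * j \<in> {..<K}"
        using ij unfolding mult_n[symmetric] lessThan_iff mult_less_cancel1 by simp_all
      moreover have "\<alpha> ^ ((q + 1) * i) = \<alpha> ^ ((q + 1) * j)"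
        using ij(3) unfolding assms(9) power_mult .
      ultimately have "(q + 1) * i = (q + 1) * j"
        using inj_onD[OF inj_\<alpha>] by blast
      then show "i = j"
        unfolding mult_cancel1 by simp
    qed
  qed
  let ?C = "\<lambda>\<delta>. bch_code \<phi> \<beta>\<^sub>1 n \<delta>" and ?C\<^sub>2 = "bch_code \<phi> \<beta>\<^sub>1 n \<delta>\<^sub>2"
  let ?codes = "\<lambda>N d. \<forall>\<delta>. \<delta>\<^sub>2 + 1 \<le> \<delta> \<and> \<delta> \<le> \<delta>\<^sub>1 \<longrightarrow>
    linear_code N (?C \<delta>) \<and> code_dim n (?C \<delta>) = d \<and> \<delta> \<le> min_dist (?C \<delta>)"
  have code: "linear_code n (?C \<delta>)" "code_dim n (?C \<delta>) = uncovered \<delta>" "\<delta> \<le> min_dist (?C \<delta>)"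
    if "\<delta> \<le> n" for \<delta>
    using code.linear_bch_code code.code_dim_bch_code code.min_dist_bch_code that by blast+
  have dims: "?codes n d"
    if "\<And>\<delta>. \<delta>\<^sub>2 < \<delta> \<Longrightarrow> \<delta> \<le> \<delta>\<^sub>1 \<Longrightarrow> uncovered \<delta> = d" and le: "\<delta>\<^sub>1 \<le> n" for d
  proof (intro allI impI)
    fix \<delta> assume \<delta>: "\<delta>\<^sub>2 + 1 \<le> \<delta> \<and> \<delta> \<le> \<delta>\<^sub>1"
    then have "\<delta> \<le> n" "uncovered \<delta> = d"
      using that by auto
    then show "linear_code n (?C \<delta>) \<and> code_dim n (?C \<delta>) = d \<and> \<delta> \<le> min_dist (?C \<delta>)"
      using code by simp
  qed
  have three: "?codes ((q ^ 6 - 1) div (q + 1)) 4 \<and> code_dim n ?C\<^sub>2 = 10 \<and> \<delta>\<^sub>2 \<le> min_dist ?C\<^sub>2"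
    if s: "s = 3"
  proof -
    have m: "2 * s = 6" and n: "(q ^ 6 - 1) div (q + 1) = n"
      using assms(4) s by simp_all
    note uncovered = uncovered_6[OF m, folded assms(10,11)]
    show ?thesis
      unfolding n using dims[OF uncovered(1,3)] code(2,3)[OF uncovered(4)] uncovered(2) by simp
  qed
  have four: "?codes ((q ^ 8 - 1) div (q + 1)) 9 \<and> (q \<noteq> 3 \<longrightarrow> code_dim n ?C\<^sub>2 = 17) \<and> \<delta>\<^sub>2 \<le> min_dist ?C\<^sub>2"
    if s: "s = 4"
  proof -
    have m: "2 * s = 8" and n: "(q ^ 8 - 1) div (q + 1) = n"
      using assms(4) s by simp_all
    note uncovered = uncovered_8[OF m, folded assms(10,11)]
    show ?thesis
      unfolding n using dims[OF uncovered(1,3)] code(2,3)[OF uncovered(4)] uncovered(2) by simp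
  qed
  have six: "?codes ((q ^ 12 - 1) div (q + 1)) 13 \<and> code_dim n ?C\<^sub>2 = 25 \<and> \<delta>\<^sub>2 \<le> min_dist ?C\<^sub>2"
    if s: "s = 6"
  proof -
    have m: "2 * s = 12" and n: "(q ^ 12 - 1) div (q + 1) = n"
      using assms(4) s by simp_all
    note uncovered = uncovered_12[OF m, folded assms(10,11)]
    show ?thesis
      unfolding n using dims[OF uncovered(1,3)] code(2,3)[OF uncovered(4)] uncovered(2) by simp
  qed
  show ?thesis
    using three four six by blast
qed

end
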